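(* Let $\mathbb{K}$ be a field of characteristic $0$ and $\lambda\in\mathbb{K}$ nonzero. Let $A$ be an associative $\mathbb{K}$-algebra and $B$ an associative $A$-bimodule. Then the triple $\big(\bigoplus_{n=1}^{\infty}C^n(B,A),\llbracket\ ,\ \rrbracket,d\big)$ is a differential graded Lie algebra, where $C^n(B,A)$ is in degree $n$.
   Context: An associative $A$-bimodule is an associative algebra $B$ (product $xy$) with linear maps $A\otimes B\to B$, $(a,x)\mapsto a\cdot x$ and $B\otimes A\to B$, $(x,a)\mapsto x\cdot a$ such that for all $a,b\in A$, $x,y\in B$: $(ab)\cdot x=a\cdot(b\cdot x)$, $(a\cdot x)\cdot b=a\cdot(x\cdot b)$, $(x\cdot a)\cdot b=x\cdot(ab)$, $(xy)\cdot a=x(y\cdot a)$, $(x\cdot a)y=x(a\cdot y)$, $(a\cdot x)y=a\cdot(xy)$. Trees. For $n\ge1$, $T_n$ is the set of planar rooted trees with $n+1$ leaves in which every internal vertex has at least two incoming edges; $T_0=\{|\}$. Leaves are labelled $0,\dots,n$ from left to right. $d_i:T_n\to T_{n-1}$ deletes the $i$-th leaf (a vertex left with a single incoming edge is suppressed). For $m,n\ge1$, $1\le i\le m$ and $T\in T_{m+n-1}$: $R_0^{m;i,n}(T)\in T_m$ is obtained from $T$ by deleting the leaves $i,\dots,i+n-2$, and $R_i^{m;i,n}(T)\in T_n$ by deleting all leaves except $i-1,i,\dots,i+n-1$. $T_1$ has one element. $T_2=\{T^{\dashv},T^{\vdash},T^{\perp}\}$, where in $T^{\dashv}$ leaves 1,2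 are joined at a vertex above the root vertex, in $T^{\vdash}$ leaves 0,1 are joined at a vertex above the root vertex, and $T^{\perp}$ has one vertex with three leaves. For a vector space $D$, $C^n(D,D)=\mathrm{Hom}(\mathbb{K}[T_n]\otimes D^{\otimes n},D)$. For $f\in C^m(D,D)$, $g\in C^n(D,D)$, $1\le i\le m$, $$(f\circ_ig)(T;x_1,\dots,x_{m+n-1})=f\big(R_0^{m;i,n}(T);x_1,\dots,x_{i-1},g(R_i^{m;i,n}(T);x_i,\dots,x_{i+n-1}),x_{i+n},\dots,x_{m+n-1}\big),$$ $$[f,g]=\sum_{i=1}^m(-1)^{(i-1)(n-1)}f\circ_ig-(-1)^{(m-1)(n-1)}\sum_{i=1}^n(-1)^{(i-1)(m-1)}g\circ_if.$$ This makes $\bigoplus_{n\ge0}C^{n+1}(D,D)$ (with $C^{n+1}$ in degree $n$) a graded Lie algebra. Take $D=A\oplus B$; $C^n(B,A)=\mathrm{Hom}(\mathbb{K}[T_n]\otimes B^{\otimes n},A)$ is viewed inside $C^n(A\oplus B,A\oplus B)$ by extending by zero. Define $\pi_\lambda\in C^2(A\oplus B,A\oplus B)$ by $\pi_\lambda(T^{\dashv};(a,x),(b,y))=(ab,x\cdot b)$, $\pi_\lambda(T^{\vdash};(a,x),(b,y))=(ab,a\cdot y)$, $\pi_\lambda(T^{\perp};(a,x),(b,y))=(ab,\lambda xy)$. The bracket is $$\llbracket f,g\rrbracket=(-1)^m[[\pi_\lambda,f],g],\qquad f\in C^m(B,A),\ g\in C^n(B,A),$$ and $d:C^n(B,A)\to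 C^{n+1}(B,A)$ is $$(df)(T;x_1,\dots,x_{n+1})=(-1)^{n-1}\sum_{i=1}^n(-1)^{i-1}f\big(d_iT;x_1,\dots,x_{i-1},\pi_\lambda(R_i^{n;i,2}(T);x_i,x_{i+1}),x_{i+2},\dots,x_{n+1}\big),$$ where $\pi_\lambda(S;x,y)$ for $x,y\in B$ equals $\lambda xy$ if $S=T^{\perp}$ and $0$ otherwise. *)

theory Defs
  imports Complex_Main "HOL-Library.Product_Plus" "HOL-Library.Function_Algebras"
begin

section \<open>Algebras and bimodules\<close>

text \<open>Algebras need not be unital, hence the type class \<open>ring\<close>, which supplies the
  associative product and its biadditivity.\<close>

locale assoc_algebra = vector_space scale
  for scale :: "'k::field \<Rightarrow> 'a::ring \<Rightarrow> 'a" +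
  assumes scale_mult_left: "scale c x * y = scale c (x * y)"
    and scale_mult_right: "x * scale c y = scale c (x * y)"

locale assoc_bimodule = A: assoc_algebra sA + B: assoc_algebra sB
  for sA :: "'k::field \<Rightarrow> 'a::ring \<Rightarrow> 'a"
    and sB :: "'k \<Rightarrow> 'b::ring \<Rightarrow> 'b" +
  fixes lact :: "'a \<Rightarrow> 'b \<Rightarrow> 'b" and ract :: "'b \<Rightarrow> 'a \<Rightarrow> 'b"
  assumes lact_linear_alg: "Vector_Spaces.linear sA sB (\<lambda>a. lact a x)"
    and lact_linear_mod: "Vector_Spaces.linear sB sB (\<lambda>x. lact a x)"
    and ract_linear_alg: "Vector_Spaces.linear sA sB (\<lambda>a. ract x a)"
    and ract_linear_mod: "Vector_Spaces.linear sB sB (\<lambda>x. ract x a)"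
    and lact_lact: "lact (a * b) x = lact a (lact b x)"
    and lact_ract: "ract (lact a x) b = lact a (ract x b)"
    and ract_ract: "ract (ract x a) b = ract x (a * b)"
    and ract_mult: "ract (x * y) a = x * ract y a"
    and mult_middle: "ract x a * y = x * lact a y"
    and lact_mult: "lact a x * y = lact a (x * y)"

section \<open>Planar trees\<close>

datatype ptree = Leaf | Node "ptree list"

fun leaves :: "ptree \<Rightarrow> nat" where
  "leaves Leaf = 1"
| "leaves (Node ts) = sum_list (map leaves ts)"

fun reduced :: "ptree \<Rightarrow> bool" where
  "reduced Leaf = True"
| "reduced (Node ts) = (length ts \<ge> 2 \<and> (\<forall>t\<in>set ts. reduced t))"

definition trees :: "nat \<Rightarrow> ptree set" where
  "trees n = {T. reduced T \<and> leaves T = n + 1}"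

text \<open>\<open>prune S k T\<close> deletes from \<open>T\<close>, whose leaves are numbered \<open>k, k + 1, \<dots>\<close> from left to
  right, every leaf with number in \<open>S\<close>. Vertices left with a single incoming edge are
  suppressed, and the result is \<open>None\<close> if no leaf remains.\<close>

fun prune :: "nat set \<Rightarrow> nat \<Rightarrow> ptree \<Rightarrow> ptree option"
  and prune_list :: "nat set \<Rightarrow> nat \<Rightarrow> ptree list \<Rightarrow> ptree list" where
  "prune S k Leaf = (if k \<in> S then None else Some Leaf)"
| "prune S k (Node ts) =
    (case prune_list S k ts of [] \<Rightarrow> None | [u] \<Rightarrow> Some u | us \<Rightarrow> Some (Node us))"
| "prune_list S k [] = []"
| "prune_list S k (t # ts) =
    (case prune S k t of None \<Rightarrow> [] | Some u \<Rightarrow> [u]) @ prune_list S (k + leaves t) ts"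

definition delete_leaves :: "nat set \<Rightarrow> ptree \<Rightarrow> ptree" where
  "delete_leaves S T = the (prune S 0 T)"

definition face :: "nat \<Rightarrow> ptree \<Rightarrow> ptree" where
  "face i T = delete_leaves {i} T"

text \<open>\<open>R_outer m i n\<close> and \<open>R_inner m i n\<close> are the maps $R_0^{m;i,n}$ and $R_i^{m;i,n}$ on
  \<open>trees (m + n - 1)\<close>, whose leaves are numbered \<open>0, \<dots>, m + n - 1\<close>.\<close>

definition R_outer :: "nat \<Rightarrow> nat \<Rightarrow> nat \<Rightarrow> ptree \<Rightarrow> ptree" where
  "R_outer m i n T = delete_leaves {i..<i + n - 1} T"

definition R_inner :: "nat \<Rightarrow> nat \<Rightarrow> nat \<Rightarrow> ptree \<Rightarrow> ptree" where
  "R_inner m i n T = delete_leaves ({0..<m + n} - {i - 1..i + n - 1}) T"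

definition T_left :: ptree where "T_left = Node [Leaf, Node [Leaf, Leaf]]"  \<comment> \<open>$T^{\dashv}$\<close>
definition T_right :: ptree where "T_right = Node [Node [Leaf, Leaf], Leaf]"  \<comment> \<open>$T^{\vdash}$\<close>
definition T_perp :: ptree where "T_perp = Node [Leaf, Leaf, Leaf]"  \<comment> \<open>$T^{\perp}$\<close>

section \<open>Cochains\<close>

text \<open>$C^n(D, E) = \mathrm{Hom}(\mathbb{K}[T_n] \otimes D^{\otimes n}, E)$ is rendered by the
  universal property of the tensor product: a cochain is a family, indexed by \<open>trees n\<close>, of
  \<open>n\<close>-linear maps, where $f(T; x_1, \dots, x_n)$ is written \<open>f T [x\<^sub>1, \<dots>, x\<^sub>n]\<close>. Cochains are
  \<open>0\<close> on all other arguments, so that equality of functions is equality of cochains.\<close>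

type_synonym ('d, 'e) cochain = "ptree \<Rightarrow> 'd list \<Rightarrow> 'e"

definition cochains ::
  "('k::field \<Rightarrow> 'd::ab_group_add \<Rightarrow> 'd) \<Rightarrow> ('k \<Rightarrow> 'e::ab_group_add \<Rightarrow> 'e) \<Rightarrow> nat \<Rightarrow> ('d, 'e) cochain set"
  where
  "cochains sD sE n = {f.
     (\<forall>T\<in>trees n. \<forall>xs. length xs = n \<longrightarrow>
        (\<forall>j<n. Vector_Spaces.linear sD sE (\<lambda>x. f T (xs[j := x])))) \<and>
     (\<forall>T xs. \<not> (T \<in> trees n \<and> length xs = n) \<longrightarrow> f T xs = 0)}"

definition scale_cochain :: "('k \<Rightarrow> 'e \<Rightarrow> 'e) \<Rightarrow> 'k \<Rightarrow> ('d, 'e) cochain \<Rightarrow> ('d, 'e) cochain" where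
  "scale_cochain sE c f = (\<lambda>T xs. sE c (f T xs))"

text \<open>\<open>sgn_pow k v\<close> is $(-1)^k v$.\<close>

definition sgn_pow :: "nat \<Rightarrow> 'v::ab_group_add \<Rightarrow> 'v" where
  "sgn_pow k v = (if even k then v else - v)"

definition circ :: "nat \<Rightarrow> nat \<Rightarrow> nat \<Rightarrow> ('d, 'd::ab_group_add) cochain \<Rightarrow> ('d, 'd) cochain \<Rightarrow> ('d, 'd) cochain"
  where
  "circ m n i f g = (\<lambda>T xs.
     if T \<in> trees (m + n - 1) \<and> length xs = m + n - 1
     then f (R_outer m i n T)
            (take (i - 1) xs @ [g (R_inner m i n T) (take n (drop (i - 1) xs))] @ drop (i - 1 + n) xs)
     else 0)"

text \<open>\<open>gbracket m n f g\<close> is $[f, g]$ for $f \in C^m(D, D)$ and $g \in C^n(D, D)$.\<close>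

definition gbracket ::
  "nat \<Rightarrow> nat \<Rightarrow> ('d, 'd::ab_group_add) cochain \<Rightarrow> ('d, 'd) cochain \<Rightarrow> ('d, 'd) cochain" where
  "gbracket m n f g =
     (\<Sum>i=1..m. sgn_pow ((i - 1) * (n - 1)) (circ m n i f g))
     - sgn_pow ((m - 1) * (n - 1)) (\<Sum>i=1..n. sgn_pow ((i - 1) * (m - 1)) (circ n m i g f))"

text \<open>Extension by zero $C^n(B, A) \hookrightarrow C^n(A \oplus B, A \oplus B)$: by multilinearity,
  only the \<open>B\<close>-components of the arguments contribute.\<close>

definition ext :: "('b, 'a::zero) cochain \<Rightarrow> ('a \<times> 'b, 'a \<times> 'b::zero) cochain" where
  "ext f = (\<lambda>T xs. (f T (map snd xs), 0))"

definition pi_cochain ::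
  "('k \<Rightarrow> 'b::ring \<Rightarrow> 'b) \<Rightarrow> ('a::ring \<Rightarrow> 'b \<Rightarrow> 'b) \<Rightarrow> ('b \<Rightarrow> 'a \<Rightarrow> 'b) \<Rightarrow> 'k
    \<Rightarrow> ('a \<times> 'b, 'a \<times> 'b) cochain" where
  "pi_cochain sB lact ract lam = (\<lambda>T xs. case xs of
     [(a, x), (b, y)] \<Rightarrow>
       if T = T_left then (a * b, ract x b)
       else if T = T_right then (a * b, lact a y)
       else if T = T_perp then (a * b, sB lam (x * y))
       else 0
   | _ \<Rightarrow> 0)"

definition derived_bracket ::
  "('k \<Rightarrow> 'b::ring \<Rightarrow> 'b) \<Rightarrow> ('a::ring \<Rightarrow> 'b \<Rightarrow> 'b) \<Rightarrow> ('b \<Rightarrow> 'a \<Rightarrow> 'b) \<Rightarrow> 'k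
    \<Rightarrow> nat \<Rightarrow> nat \<Rightarrow> ('b, 'a) cochain \<Rightarrow> ('b, 'a) cochain \<Rightarrow> ('a \<times> 'b, 'a \<times> 'b) cochain" where
  "derived_bracket sB lact ract lam m n f g =
     sgn_pow m (gbracket (m + 1) n (gbracket 2 m (pi_cochain sB lact ract lam) (ext f)) (ext g))"

text \<open>The derived bracket as an element of $C^{m+n}(B, A)$: its unique preimage there under
  extension by zero.\<close>

definition dbracket ::
  "('k::field \<Rightarrow> 'a::ring \<Rightarrow> 'a) \<Rightarrow> ('k \<Rightarrow> 'b::ring \<Rightarrow> 'b) \<Rightarrow> ('a \<Rightarrow> 'b \<Rightarrow> 'b) \<Rightarrow> ('b \<Rightarrow> 'a \<Rightarrow> 'b) \<Rightarrow> 'k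
    \<Rightarrow> nat \<Rightarrow> nat \<Rightarrow> ('b, 'a) cochain \<Rightarrow> ('b, 'a) cochain \<Rightarrow> ('b, 'a) cochain" where
  "dbracket sA sB lact ract lam m n f g =
     the_inv_into (cochains sB sA (m + n)) ext (derived_bracket sB lact ract lam m n f g)"

definition pi_B :: "('k \<Rightarrow> 'b::ring \<Rightarrow> 'b) \<Rightarrow> 'k \<Rightarrow> ptree \<Rightarrow> 'b \<Rightarrow> 'b \<Rightarrow> 'b" where
  "pi_B sB lam S x y = (if S = T_perp then sB lam (x * y) else 0)"

text \<open>\<open>xs ! (i - 1)\<close> is $x_i$.\<close>

definition differential ::
  "('k \<Rightarrow> 'b::ring \<Rightarrow> 'b) \<Rightarrow> 'k \<Rightarrow> nat \<Rightarrow> ('b, 'a::ab_group_add) cochain \<Rightarrow> ('b, 'a) cochain" where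
  "differential sB lam n f = (\<lambda>T xs.
     if T \<in> trees (n + 1) \<and> length xs = n + 1
     then sgn_pow (n - 1) (\<Sum>i=1..n. sgn_pow (i - 1)
            (f (face i T)
               (take (i - 1) xs @ [pi_B sB lam (R_inner n i 2 T) (xs ! (i - 1)) (xs ! i)] @ drop (i + 1) xs)))
     else 0)"

section \<open>Differential graded Lie algebras\<close>

text \<open>Differential graded Lie algebras $\bigoplus_{n \ge 1} L_n$ concentrated in positive degrees,
  with differential of degree 1. The operations are given by their homogeneous components
  \<open>br m n\<close> on $L_m \times L_n$ and \<open>d n\<close> on $L_n$.\<close>

locale positively_graded_dgla = vector_space scale
  for scale :: "'k::field \<Rightarrow> 'v::ab_group_add \<Rightarrow> 'v" +
  fixes L :: "nat \<Rightarrow> 'v set"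
    and br :: "nat \<Rightarrow> nat \<Rightarrow> 'v \<Rightarrow> 'v \<Rightarrow> 'v"
    and d :: "nat \<Rightarrow> 'v \<Rightarrow> 'v"
  assumes subspace_L: "n \<ge> 1 \<Longrightarrow> subspace (L n)"
    and br_closed: "\<lbrakk>m \<ge> 1; n \<ge> 1; f \<in> L m; g \<in> L n\<rbrakk> \<Longrightarrow> br m n f g \<in> L (m + n)"
    and br_add_left: "\<lbrakk>m \<ge> 1; n \<ge> 1; f \<in> L m; f' \<in> L m; g \<in> L n\<rbrakk>
          \<Longrightarrow> br m n (f + f') g = br m n f g + br m n f' g"
    and br_scale_left: "\<lbrakk>m \<ge> 1; n \<ge> 1; f \<in> L m; g \<in> L n\<rbrakk>
          \<Longrightarrow> br m n (scale c f) g = scale c (br m n f g)"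
    and br_add_right: "\<lbrakk>m \<ge> 1; n \<ge> 1; f \<in> L m; g \<in> L n; g' \<in> L n\<rbrakk>
          \<Longrightarrow> br m n f (g + g') = br m n f g + br m n f g'"
    and br_scale_right: "\<lbrakk>m \<ge> 1; n \<ge> 1; f \<in> L m; g \<in> L n\<rbrakk>
          \<Longrightarrow> br m n f (scale c g) = scale c (br m n f g)"
    and br_skew: "\<lbrakk>m \<ge> 1; n \<ge> 1; f \<in> L m; g \<in> L n\<rbrakk>
          \<Longrightarrow> br m n f g = - sgn_pow (m * n) (br n m g f)"
    and br_jacobi: "\<lbrakk>m \<ge> 1; n \<ge> 1; p \<ge> 1; f \<in> L m; g \<in> L n; h \<in> L p\<rbrakk>
          \<Longrightarrow> br m (n + p) f (br n p g h) =
              br (m + n) p (br m n f g) h + sgn_pow (m * n) (br n (m + p) g (br m p f h))"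
    and d_closed: "\<lbrakk>n \<ge> 1; f \<in> L n\<rbrakk> \<Longrightarrow> d n f \<in> L (n + 1)"
    and d_add: "\<lbrakk>n \<ge> 1; f \<in> L n; f' \<in> L n\<rbrakk> \<Longrightarrow> d n (f + f') = d n f + d n f'"
    and d_scale: "\<lbrakk>n \<ge> 1; f \<in> L n\<rbrakk> \<Longrightarrow> d n (scale c f) = scale c (d n f)"
    and d_square: "\<lbrakk>n \<ge> 1; f \<in> L n\<rbrakk> \<Longrightarrow> d (n + 1) (d n f) = 0"
    and d_leibniz: "\<lbrakk>m \<ge> 1; n \<ge> 1; f \<in> L m; g \<in> L n\<rbrakk>
          \<Longrightarrow> d (m + n) (br m n f g) =
              br (m + 1) n (d m f) g + sgn_pow m (br m (n + 1) f (d n g))"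

end

(* Deleting sets of leaves is functorial, so the partial compositions on the cochains of a vector
   space satisfy the sequential and parallel axioms of a nonsymmetric operad, and the alternating sum
   of the partial compositions is a graded pre-Lie product whose commutator is the given bracket.
   The bimodule axioms say that [pi_c, pi_d] = 0 for all scalars c and d. Hence pi = pi_lam and
   rho = pi_lam - pi_0, which only involves the product of B, satisfy
   [pi, pi] = [rho, pi] = [rho, rho] = 0.

   C(B, A) is abelian for the graded Lie bracket, its derived bracket is +-[[pi, f], g], and the
   differential is d f = -[rho, f]. Jacobi for the derived bracket follows from
   [pi, [[pi, f], g]] = +-[[pi, f], [pi, g]], skew symmetry from [f, g] = 0, the Leibniz rule from
   [rho, pi] = 0 and d^2 = 0 from [rho, rho] = 0. *)

theory Submission
  imports Defs
begin

section \<open>Deletion of leaves\<close>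

text \<open>A surviving leaf x is renumbered by the number of survivors to its left, so each
  identity between iterated deletions becomes an identity of sets of natural numbers, decided by
  interval arithmetic. The shape of a tree matters again only for trees with at most four leaves.
  Everything is indexed by degree, that is arity minus one: slots run from 0, \<pi> has degree one,
  and the signs of the bracket become (-1)^(i n). The step that is not formal is closure. In general
  [\<pi>, f] does not lie in C(B, A), since its values may have a B-component and it sees the
  A-components of its arguments; yet its bracket with g does lie there.\<close>

lemma leaves_pos: "reduced T \<Longrightarrow> 0 < leaves T"
proof (induction T)
  case (Node ts)
  then obtain t where "t \<in> set ts" by (cases ts) auto
  with Node have "0 < leaves t" by auto
  moreover have "leaves t \<le> leaves (Node ts)"
    using \<open>t \<in> set ts\<close> by (simp add: member_le_sum_list)
  ultimately show ?case by simp
qed simp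

lemma card_Diff_split:
  fixes a b c :: nat
  assumes "a \<le> b" "b \<le> c"
  shows "card ({a..<c} - S) = card ({a..<b} - S) + card ({b..<c} - S)"
proof -
  have "{a..<c} - S = ({a..<b} - S) \<union> ({b..<c} - S)" using assms by auto
  then show ?thesis by (simp add: card_Un_disjoint disjoint_iff)
qed

text \<open>\<open>None\<close> counts as 0 leaves. Expressing the survivors as a cardinality lets
  the sum over the children follow by splitting the interval of leaf numbers.\<close>

lemma leaves_prune:
  "(case prune S k T of None \<Rightarrow> 0 | Some u \<Rightarrow> leaves u) = card ({k..<k + leaves T} - S)"
  "sum_list (map leaves (prune_list S k ts)) = card ({k..<k + sum_list (map leaves ts)} - S)"
proof (induction S k T and S k ts rule: prune_prune_list.induct)
  case (1 S k)
  then show ?case by (cases "k \<in> S") (simp_all add: Diff_triv)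
next
  case (2 S k ts)
  have "(case prune S k (Node ts) of None \<Rightarrow> 0 | Some u \<Rightarrow> leaves u)
      = sum_list (map leaves (prune_list S k ts))"
    by (auto split: list.splits)
  with 2 show ?case by (simp only: leaves.simps)
next
  case (3 S k)
  then show ?case by simp
next
  case (4 S k t ts)
  have "card ({k..<k + sum_list (map leaves (t # ts))} - S)
      = card ({k..<k + leaves t} - S)
        + card ({k + leaves t..<k + leaves t + sum_list (map leaves ts)} - S)"
    by (subst card_Diff_split[of k "k + leaves t"]) (auto simp: add.assoc)
  with 4 show ?case by (auto split: option.splits)
qed

lemma reduced_prune:
  "reduced T \<Longrightarrow> prune S k T = Some u \<Longrightarrow> reduced u"
  "\<forall>t\<in>set ts. reduced t \<Longrightarrow> \<forall>t\<in>set (prune_list S k ts). reduced t"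
proof (induction S k T and S k ts arbitrary: u rule: prune_prune_list.induct)
  case (2 S k ts)
  then show ?case by (auto split: list.splits)
qed (auto split: if_splits option.splits)

text \<open>Leaf x, if it survives \<open>S1\<close>, gets number
  \<open>k' + card ({k..<x} - S1)\<close> in the pruned tree, so the hypothesis says that
  \<open>S\<close> is \<open>S1\<close> together with the pullback of \<open>S2\<close> under this
  renumbering. The start \<open>k'\<close> stays arbitrary because a later child begins at a number
  advanced by the survivors of the earlier ones.\<close>

lemma prune_prune:
  "(\<And>x. k \<le> x \<Longrightarrow> x < k + leaves T \<Longrightarrow>
      x \<in> S \<longleftrightarrow> x \<in> S1 \<or> k' + card ({k..<x} - S1) \<in> S2)
    \<Longrightarrow> Option.bind (prune S1 k T) (prune S2 k') = prune S k T"
  "(\<And>x. k \<le> x \<Longrightarrow> x < k + sum_list (map leaves ts) \<Longrightarrow>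
      x \<in> S \<longleftrightarrow> x \<in> S1 \<or> k' + card ({k..<x} - S1) \<in> S2)
    \<Longrightarrow> prune_list S2 k' (prune_list S1 k ts) = prune_list S k ts"
proof (induction S1 k T and S1 k ts arbitrary: k' and k' rule: prune_prune_list.induct)
  case (1 S1 k)
  then show ?case by auto
next
  case (2 S1 k ts)
  have IH: "prune_list S2 k' (prune_list S1 k ts) = prune_list S k ts"
    using 2 by simp
  \<comment> \<open>The shapes are those distinguished by \<open>prune\<close>: nothing left, a
    suppressed vertex, a vertex kept. In the second one the next pruning acts on \<open>u\<close>
    alone from the same start \<open>k'\<close>, so suppressing early or late gives the same
    tree.\<close>
  consider "prune_list S1 k ts = []" | u where "prune_list S1 k ts = [u]"
    | u v us where "prune_list S1 k ts = u # v # us"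
    by (metis list.exhaust)
  then show ?case
    by cases (use IH in \<open>auto split: option.splits simp flip: IH\<close>)
next
  case (3 S1 k)
  then show ?case by simp
next
  case (4 S1 k t ts)
  have A: "Option.bind (prune S1 k t) (prune S2 k') = prune S k t"
    by (rule "4.IH"(1)) (use "4.prems" in auto)
  have B: "prune_list S2 (k' + card ({k..<k + leaves t} - S1)) (prune_list S1 (k + leaves t) ts)
      = prune_list S (k + leaves t) ts"
  proof (rule "4.IH"(2))
    fix x assume x: "k + leaves t \<le> x" "x < k + leaves t + sum_list (map leaves ts)"
    show "x \<in> S \<longleftrightarrow> x \<in> S1 \<or>
        k' + card ({k..<k + leaves t} - S1) + card ({k + leaves t..<x} - S1) \<in> S2"
      using "4.prems"[of x] card_Diff_split[of k "k + leaves t" x S1] x by (simp add: add.assoc)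
  qed
  show ?case
  proof (cases "prune S1 k t")
    \<comment> \<open>No leaf of \<open>t\<close> survives, so the numbering used for
      \<open>S2\<close> does not advance past this child.\<close>
    case None
    then have "card ({k..<k + leaves t} - S1) = 0" "prune S k t = None"
      using A leaves_prune(1)[of S1 k t] by auto
    with None B show ?thesis by (simp del: card_eq_0_iff)
  next
    case (Some u)
    with A B leaves_prune(1)[of S1 k t] show ?thesis by simp
  qed
qed

text \<open>One surviving leaf rules out \<open>None\<close>, so \<open>the\<close> in
  \<open>delete_leaves\<close> is not applied to an unspecified case.\<close>

lemma delete_leaves_Some:
  assumes "x < leaves T" "x \<notin> S"
  shows "prune S 0 T = Some (delete_leaves S T)"
proof -
  have "card ({0..<0 + leaves T} - S) \<noteq> 0"
    using assms by auto
  then show ?thesis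
    using leaves_prune(1)[of S 0 T] by (auto simp: delete_leaves_def split: option.splits)
qed

lemma delete_leaves_trees:
  assumes "T \<in> trees n" "card ({0..<n + 1} - S) = p + 1"
  shows "delete_leaves S T \<in> trees p"
proof -
  obtain u where "prune S 0 T = Some u" "leaves u = p + 1"
    using assms leaves_prune(1)[of S 0 T] by (auto simp: trees_def split: option.splits)
  moreover have "reduced u"
    using reduced_prune(1) assms(1) calculation(1) by (auto simp: trees_def)
  ultimately show ?thesis by (simp add: delete_leaves_def trees_def)
qed

text \<open>The witness x keeps the intermediate tree from being \<open>None\<close>; the rest is
  \<open>prune_prune\<close> with both numberings starting at 0.\<close>

lemma delete_leaves_delete_leaves:
  assumes T: "T \<in> trees n" and x: "x \<le> n" "x \<notin> S1"
    and S: "\<And>x. x \<le> n \<Longrightarrow> x \<in> S \<longleftrightarrow> x \<in> S1 \<or> card ({0..<x} - S1) \<in> S2"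
  shows "delete_leaves S2 (delete_leaves S1 T) = delete_leaves S T"
proof -
  have "prune S1 0 T = Some (delete_leaves S1 T)"
    using T x by (intro delete_leaves_Some[of x]) (auto simp: trees_def)
  moreover have "Option.bind (prune S1 0 T) (prune S2 0) = prune S 0 T"
    using T S by (intro prune_prune(1)) (auto simp: trees_def)
  ultimately show ?thesis unfolding delete_leaves_def by (metis Option.bind.bind_lunit)
qed

section \<open>Graded pre-Lie algebras and derived brackets\<close>

lemma sgn_pow_zero [simp]: "sgn_pow k 0 = 0"
  by (simp add: sgn_pow_def)

lemma sgn_pow_add: "sgn_pow k (u + v) = sgn_pow k u + sgn_pow k v"
  by (simp add: sgn_pow_def)

lemma sgn_pow_minus: "sgn_pow k (- v) = - sgn_pow k v"
  by (simp add: sgn_pow_def)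

lemma sgn_pow_sum: "sgn_pow k (\<Sum>i\<in>A. h i) = (\<Sum>i\<in>A. sgn_pow k (h i))"
  by (simp add: sgn_pow_def sum_negf)

lemma sgn_pow_sgn_pow: "sgn_pow k (sgn_pow l v) = sgn_pow (k + l) v"
  by (simp add: sgn_pow_def)

text \<open>This is the right-handed version: the associator is graded symmetric in its last two
  arguments. It is the form that insertion into slots satisfies, since g and h may be put into two
  slots of f in either order.\<close>

locale graded_pre_lie = vector_space scale
  for scale :: "'k::field_char_0 \<Rightarrow> 'v::ab_group_add \<Rightarrow> 'v" +
  fixes C :: "nat \<Rightarrow> 'v set"
    and pl :: "nat \<Rightarrow> nat \<Rightarrow> 'v \<Rightarrow> 'v \<Rightarrow> 'v"
  assumes subspace_C: "subspace (C n)"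
    and pl_closed: "f \<in> C m \<Longrightarrow> g \<in> C n \<Longrightarrow> pl m n f g \<in> C (m + n)"
    and pl_add_left: "f \<in> C m \<Longrightarrow> f' \<in> C m \<Longrightarrow> g \<in> C n
      \<Longrightarrow> pl m n (f + f') g = pl m n f g + pl m n f' g"
    and pl_scale_left: "f \<in> C m \<Longrightarrow> g \<in> C n \<Longrightarrow> pl m n (scale c f) g = scale c (pl m n f g)"
    and pl_add_right: "f \<in> C m \<Longrightarrow> g \<in> C n \<Longrightarrow> g' \<in> C n
      \<Longrightarrow> pl m n f (g + g') = pl m n f g + pl m n f g'"
    and pl_scale_right: "f \<in> C m \<Longrightarrow> g \<in> C n \<Longrightarrow> pl m n f (scale c g) = scale c (pl m n f g)"
    and pl_associator: "f \<in> C m \<Longrightarrow> g \<in> C n \<Longrightarrow> h \<in> C p \<Longrightarrow>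
      pl (m + n) p (pl m n f g) h - pl m (n + p) f (pl n p g h)
      = sgn_pow (n * p) (pl (m + p) n (pl m p f h) g - pl m (p + n) f (pl p n h g))"
begin

lemma C_minus: "f \<in> C n \<Longrightarrow> - f \<in> C n"
  and C_diff: "f \<in> C n \<Longrightarrow> g \<in> C n \<Longrightarrow> f - g \<in> C n"
  and C_zero: "0 \<in> C n"
  using subspace_C[of n] by (auto simp: subspace_neg subspace_diff subspace_0)

lemma C_sgn_pow: "f \<in> C n \<Longrightarrow> sgn_pow k f \<in> C n"
  by (simp add: sgn_pow_def C_minus)

lemma scale_sgn_pow: "scale c (sgn_pow k v) = sgn_pow k (scale c v)"
  by (simp add: sgn_pow_def)

lemma pl_minus_left: "f \<in> C m \<Longrightarrow> g \<in> C n \<Longrightarrow> pl m n (- f) g = - pl m n f g"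
  using pl_scale_left[of f m g n "- 1"] by simp

lemma pl_minus_right: "f \<in> C m \<Longrightarrow> g \<in> C n \<Longrightarrow> pl m n f (- g) = - pl m n f g"
  using pl_scale_right[of f m g n "- 1"] by simp

lemma pl_sgn_left: "f \<in> C m \<Longrightarrow> g \<in> C n \<Longrightarrow> pl m n (sgn_pow k f) g = sgn_pow k (pl m n f g)"
  by (simp add: sgn_pow_def pl_minus_left)

lemma pl_sgn_right: "f \<in> C m \<Longrightarrow> g \<in> C n \<Longrightarrow> pl m n f (sgn_pow k g) = sgn_pow k (pl m n f g)"
  by (simp add: sgn_pow_def pl_minus_right)

lemma pl_diff_left: "f \<in> C m \<Longrightarrow> f' \<in> C m \<Longrightarrow> g \<in> C n
    \<Longrightarrow> pl m n (f - f') g = pl m n f g - pl m n f' g"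
  using pl_add_left[of f m "- f'" g n] by (simp add: pl_minus_left C_minus)

lemma pl_diff_right: "f \<in> C m \<Longrightarrow> g \<in> C n \<Longrightarrow> g' \<in> C n
    \<Longrightarrow> pl m n f (g - g') = pl m n f g - pl m n f g'"
  using pl_add_right[of f m g n "- g'"] by (simp add: pl_minus_right C_minus)

definition br :: "nat \<Rightarrow> nat \<Rightarrow> 'v \<Rightarrow> 'v \<Rightarrow> 'v" where
  "br m n f g = pl m n f g - sgn_pow (m * n) (pl n m g f)"

lemma pl_closed': "f \<in> C m \<Longrightarrow> g \<in> C n \<Longrightarrow> pl m n f g \<in> C (n + m)"
  using pl_closed[of f m g n] by (simp add: add.commute)

lemma br_closed: "f \<in> C m \<Longrightarrow> g \<in> C n \<Longrightarrow> br m n f g \<in> C (m + n)"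
  unfolding br_def by (intro C_diff C_sgn_pow pl_closed pl_closed')

lemma br_add_left: "f \<in> C m \<Longrightarrow> f' \<in> C m \<Longrightarrow> g \<in> C n
    \<Longrightarrow> br m n (f + f') g = br m n f g + br m n f' g"
  by (simp add: br_def pl_add_left pl_add_right sgn_pow_add)

lemma br_add_right: "f \<in> C m \<Longrightarrow> g \<in> C n \<Longrightarrow> g' \<in> C n
    \<Longrightarrow> br m n f (g + g') = br m n f g + br m n f g'"
  by (simp add: br_def pl_add_left pl_add_right sgn_pow_add)

lemma br_scale_left: "f \<in> C m \<Longrightarrow> g \<in> C n \<Longrightarrow> br m n (scale c f) g = scale c (br m n f g)"
  by (simp add: br_def pl_scale_left pl_scale_right scale_right_diff_distrib scale_sgn_pow)

lemma br_scale_right: "f \<in> C m \<Longrightarrow> g \<in> C n \<Longrightarrow> br m n f (scale c g) = scale c (br m n f g)"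
  by (simp add: br_def pl_scale_left pl_scale_right scale_right_diff_distrib scale_sgn_pow)

lemma br_minus_right: "f \<in> C m \<Longrightarrow> g \<in> C n \<Longrightarrow> br m n f (- g) = - br m n f g"
  using br_scale_right[of f m g n "- 1"] by simp

lemma br_sgn_right: "f \<in> C m \<Longrightarrow> g \<in> C n \<Longrightarrow> br m n f (sgn_pow k g) = sgn_pow k (br m n f g)"
  by (simp add: sgn_pow_def br_minus_right)

lemma br_zero_left: "g \<in> C n \<Longrightarrow> br m n 0 g = 0"
  using br_scale_left[of 0 m g n 0] by (simp add: C_zero)

lemma br_zero_right: "f \<in> C m \<Longrightarrow> br m n f 0 = 0"
  using br_scale_right[of f m 0 n 0] by (simp add: C_zero)

lemma br_skew: "br m n f g = - sgn_pow (m * n) (br n m g f)"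
  by (simp add: br_def sgn_pow_def mult.commute)

text \<open>Expanding the three double brackets gives twelve terms. The associator identity is used
  once with each of f, g, h in front; substituting these leaves a signed identity that holds for
  every choice of parities of m, n, p.\<close>

lemma br_jacobi:
  assumes f: "f \<in> C m" and g: "g \<in> C n" and h: "h \<in> C p"
  shows "br m (n + p) f (br n p g h) =
    br (m + n) p (br m n f g) h + sgn_pow (m * n) (br n (m + p) g (br m p f h))"
proof -
  note c = f g h pl_closed pl_closed' C_sgn_pow
  have "br m (n + p) f (br n p g h) =
      pl m (n + p) f (pl n p g h) - sgn_pow (n * p) (pl m (p + n) f (pl p n h g))
      - sgn_pow (m * (n + p)) (pl (n + p) m (pl n p g h) f
        - sgn_pow (n * p) (pl (p + n) m (pl p n h g) f))"
    by (simp add: br_def c pl_diff_left pl_diff_right pl_sgn_left pl_sgn_right add.commute)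
  moreover have "br (m + n) p (br m n f g) h =
      pl (m + n) p (pl m n f g) h - sgn_pow (m * n) (pl (n + m) p (pl n m g f) h)
      - sgn_pow ((m + n) * p) (pl p (m + n) h (pl m n f g)
        - sgn_pow (m * n) (pl p (n + m) h (pl n m g f)))"
    by (simp add: br_def c pl_diff_left pl_diff_right pl_sgn_left pl_sgn_right add.commute)
  moreover have "br n (m + p) g (br m p f h) =
      pl n (m + p) g (pl m p f h) - sgn_pow (m * p) (pl n (p + m) g (pl p m h f))
      - sgn_pow (n * (m + p)) (pl (m + p) n (pl m p f h) g
        - sgn_pow (m * p) (pl (p + m) n (pl p m h f) g))"
    by (simp add: br_def c pl_diff_left pl_diff_right pl_sgn_left pl_sgn_right add.commute)
  moreover have "pl (m + n) p (pl m n f g) h = pl m (n + p) f (pl n p g h)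
      + sgn_pow (n * p) (pl (m + p) n (pl m p f h) g - pl m (p + n) f (pl p n h g))"
    using pl_associator[OF f g h] by (simp add: algebra_simps)
  moreover have "pl (n + m) p (pl n m g f) h = pl n (m + p) g (pl m p f h)
      + sgn_pow (m * p) (pl (n + p) m (pl n p g h) f - pl n (p + m) g (pl p m h f))"
    using pl_associator[OF g f h] by (simp add: algebra_simps)
  moreover have "pl (p + m) n (pl p m h f) g = pl p (m + n) h (pl m n f g)
      + sgn_pow (m * n) (pl (p + n) m (pl p n h g) f - pl p (n + m) h (pl n m g f))"
    using pl_associator[OF h f g] by (simp add: algebra_simps)
  ultimately show ?thesis
    by (cases "even m"; cases "even n"; cases "even p") (simp_all add: sgn_pow_def)
qed

section \<open>Brackets with an element of degree one, and derived brackets\<close>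

lemma br_1_jacobi:
  assumes "P \<in> C (Suc 0)" "f \<in> C m" "g \<in> C n"
  shows "br (Suc 0) (m + n) P (br m n f g) =
    br (Suc m) n (br (Suc 0) m P f) g + sgn_pow m (br m (Suc n) f (br (Suc 0) n P g))"
  using br_jacobi[of P "Suc 0" f m g n] assms by simp

lemma br_1_closed: "P \<in> C (Suc 0) \<Longrightarrow> f \<in> C m \<Longrightarrow> br (Suc 0) m P f \<in> C (Suc m)"
  using br_closed[of P "Suc 0" f m] by simp

lemma br_1_anticommute:
  assumes "P \<in> C (Suc 0)" "Q \<in> C (Suc 0)" "br (Suc 0) (Suc 0) P Q = 0" "f \<in> C m"
  shows "br (Suc 0) (Suc m) P (br (Suc 0) m Q f) = - br (Suc 0) (Suc m) Q (br (Suc 0) m P f)"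
  using br_1_jacobi[of P Q 1 f m] assms by (simp add: br_zero_left sgn_pow_def)

text \<open>Anticommutation with Q = P gives 2 [P, [P, f]] = 0, and 2 is invertible in
  characteristic 0.\<close>

lemma br_1_square:
  assumes "P \<in> C (Suc 0)" "br (Suc 0) (Suc 0) P P = 0" "f \<in> C m"
  shows "br (Suc 0) (Suc m) P (br (Suc 0) m P f) = 0"
proof -
  have "scale 2 (br (Suc 0) (Suc m) P (br (Suc 0) m P f)) = 0"
    using br_1_anticommute[of P P f m] assms scale_left_distrib[of 1 1] by (simp flip: eq_neg_iff_add_eq_0)
  then show ?thesis by (simp add: scale_eq_0_iff)
qed

text \<open>The sign is -1 to the arity \<open>Suc m\<close> of f, in agreement with the sign in
  \<open>derived_bracket\<close>. As P has degree one, the result has degree m + n + 1, so that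
  arities add.\<close>

definition derived :: "'v \<Rightarrow> nat \<Rightarrow> nat \<Rightarrow> 'v \<Rightarrow> 'v \<Rightarrow> 'v" where
  "derived P m n f g = sgn_pow (Suc m) (br (Suc m) n (br (Suc 0) m P f) g)"

lemma derived_closed:
  "P \<in> C (Suc 0) \<Longrightarrow> f \<in> C m \<Longrightarrow> g \<in> C n \<Longrightarrow> derived P m n f g \<in> C (Suc (m + n))"
  unfolding derived_def using br_closed[OF br_1_closed] by (intro C_sgn_pow) simp

text \<open>Apply the odd derivation [P, -] to [f, g] = 0 and turn the second resulting term around
  by skew symmetry.\<close>

lemma derived_skew:
  assumes "P \<in> C (Suc 0)" "f \<in> C m" "g \<in> C n" "br m n f g = 0"
  shows "derived P m n f g = - sgn_pow (Suc m * Suc n) (derived P n m g f)"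
proof -
  have "br (Suc m) n (br (Suc 0) m P f) g = - sgn_pow m (br m (Suc n) f (br (Suc 0) n P g))"
    using br_1_jacobi[of P f m g n] assms by (simp add: br_zero_right eq_neg_iff_add_eq_0)
  also have "br m (Suc n) f (br (Suc 0) n P g) = - sgn_pow (m * Suc n) (br (Suc n) m (br (Suc 0) n P g) f)"
    by (rule br_skew)
  finally show ?thesis
    by (cases "even m"; cases "even n") (simp_all add: derived_def sgn_pow_def)
qed

text \<open>Since [P, [P, f]] = 0, one term of the Leibniz rule drops, and the sign in
  \<open>derived\<close> cancels that of the other. Thus [P, -] carries the derived bracket to the
  original one.\<close>

lemma br_derived:
  assumes "P \<in> C (Suc 0)" "br (Suc 0) (Suc 0) P P = 0" "f \<in> C m" "g \<in> C n"
  shows "br (Suc 0) (Suc (m + n)) P (derived P m n f g) = br (Suc m) (Suc n) (br (Suc 0) m P f) (br (Suc 0) n P g)"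
  using br_1_jacobi[of P "br (Suc 0) m P f" "Suc m" g n] assms br_closed[OF br_1_closed, of P f m g n]
  by (simp add: derived_def br_sgn_right br_1_closed br_1_square br_zero_left sgn_pow_sgn_pow)
    (simp add: sgn_pow_def)

text \<open>This is Jacobi for [P, f], [P, g] and h: by \<open>br_derived\<close> the element
  [[P, f], [P, g]] is [P, -] of a derived bracket, so bracketing it with h gives an iterated derived
  bracket.\<close>

lemma derived_jacobi:
  assumes P: "P \<in> C (Suc 0)" "br (Suc 0) (Suc 0) P P = 0" and f: "f \<in> C m" and g: "g \<in> C n" and h: "h \<in> C p"
  shows "derived P m (Suc (n + p)) f (derived P n p g h) =
    derived P (Suc (m + n)) p (derived P m n f g) h
    + sgn_pow (Suc m * Suc n) (derived P n (Suc (m + p)) g (derived P m p f h))"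
proof -
  have D: "br (Suc 0) m P f \<in> C (Suc m)" "br (Suc 0) n P g \<in> C (Suc n)"
    using P f g by (auto intro: br_1_closed)
  have B: "br (Suc n) p (br (Suc 0) n P g) h \<in> C (Suc (n + p))" "br (Suc m) p (br (Suc 0) m P f) h \<in> C (Suc (m + p))"
    using br_closed[OF D(1) h] br_closed[OF D(2) h] by simp_all
  show ?thesis
    using br_jacobi[OF D h] br_derived[OF P f g]
    by (simp add: derived_def[of P m "Suc (n + p)"] derived_def[of P "Suc (m + n)" p]
        derived_def[of P n "Suc (m + p)"] derived_def[of P n p] derived_def[of P m p]
        br_sgn_right D B sgn_pow_add sgn_pow_sgn_pow)
      (cases "even m"; cases "even n"; simp add: sgn_pow_def)
qed

lemma derived_leibniz:
  assumes Q: "Q \<in> C (Suc 0)" and P: "P \<in> C (Suc 0)" "br (Suc 0) (Suc 0) Q P = 0" and f: "f \<in> C m" and g: "g \<in> C n"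
  shows "- br (Suc 0) (Suc (m + n)) Q (derived P m n f g) =
    derived P (Suc m) n (- br (Suc 0) m Q f) g + sgn_pow (Suc m) (derived P m (Suc n) f (- br (Suc 0) n Q g))"
proof -
  have D: "br (Suc 0) m P f \<in> C (Suc m)" "br (Suc 0) m Q f \<in> C (Suc m)" "br (Suc 0) n Q g \<in> C (Suc n)"
    using P Q f g by (auto intro: br_1_closed)
  have B: "br (Suc m) n (br (Suc 0) m P f) g \<in> C (Suc (m + n))"
    using br_closed[OF D(1) g] by simp
  have E: "br (Suc 0) (Suc m) P (br (Suc 0) m Q f) \<in> C (Suc (Suc m))" "br (Suc 0) (Suc m) Q (br (Suc 0) m P f) \<in> C (Suc (Suc m))"
    using P Q D by (auto intro: br_1_closed)
  \<comment> \<open>The minus sign in front of [Q, f] absorbs the one produced when P and Q are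
    exchanged.\<close>
  have "br (Suc 0) (Suc m) P (- br (Suc 0) m Q f) = br (Suc 0) (Suc m) Q (br (Suc 0) m P f)"
    using br_1_anticommute[OF Q P f] P D by (simp add: br_minus_right)
  then show ?thesis
    using br_1_jacobi[OF Q D(1) g] P
    by (simp add: derived_def br_sgn_right br_minus_right D B C_minus sgn_pow_minus sgn_pow_add
        sgn_pow_sgn_pow Q)
      (simp add: sgn_pow_def)
qed

end

section \<open>Partial compositions\<close>

text \<open>The renumbering effected by \<open>R_outer\<close>: the deleted gap closes, and the
  leaves beyond it move left by its length.\<close>

lemma card_Diff_interval:
  fixes a b x :: nat
  assumes "a \<le> b"
  shows "card ({0..<x} - {a..<b}) = (if x \<le> a then x else if x \<le> b then a else x - (b - a))"
proof -
  have "{0..<x} - {a..<b} = {0..<min x a} \<union> {b..<x}" using assms by auto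
  moreover have "card ({0..<min x a} \<union> {b..<x}) = min x a + (x - b)"
    using assms by (subst card_Un_disjoint) auto
  ultimately show ?thesis using assms by auto
qed

text \<open>The renumbering effected by \<open>R_inner\<close> on the window of leaves that it
  keeps.\<close>

lemma card_Diff_compl_interval:
  fixes a b x :: nat
  assumes "a \<le> x" "x \<le> Suc b" "x \<le> N"
  shows "card ({0..<x} - ({0..<N} - {a..b})) = x - a"
proof -
  have "{0..<x} - ({0..<N} - {a..b}) = {a..<x}" using assms by auto
  then show ?thesis by simp
qed

text \<open>Both composites equal the single deletion of the leaves lost at either stage. This
  serves the relations in which that set is neither an interval nor the complement of one.\<close>

lemma delete_leaves_comp_eq:
  assumes T: "T \<in> trees N" and x: "x \<le> N" "x \<notin> S1" and x': "x' \<le> N" "x' \<notin> S1'"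
    and S: "\<And>x. x \<le> N \<Longrightarrow> (x \<in> S1 \<or> card ({0..<x} - S1) \<in> S2)
      \<longleftrightarrow> (x \<in> S1' \<or> card ({0..<x} - S1') \<in> S2')"
  shows "delete_leaves S2 (delete_leaves S1 T) = delete_leaves S2' (delete_leaves S1' T)"
proof -
  let ?S = "S1 \<union> {x. card ({0..<x} - S1) \<in> S2}"
  have "delete_leaves S2 (delete_leaves S1 T) = delete_leaves ?S T"
    by (rule delete_leaves_delete_leaves[OF T x]) auto
  also have "delete_leaves ?S T = delete_leaves S2' (delete_leaves S1' T)"
    by (rule sym, rule delete_leaves_delete_leaves[OF T x']) (use S in auto)
  finally show ?thesis .
qed

section \<open>Relations between outer and inner trees\<close>

lemma R_outer_trees:
  assumes "T \<in> trees (Suc (m + n))" "i \<le> m"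
  shows "R_outer (Suc m) (Suc i) (Suc n) T \<in> trees (Suc m)"
  unfolding R_outer_def
  by (rule delete_leaves_trees[OF assms(1)]) (use assms(2) in \<open>simp add: card_Diff_interval\<close>)

lemma R_inner_trees:
  assumes "T \<in> trees (Suc (m + n))" "i \<le> m"
  shows "R_inner (Suc m) (Suc i) (Suc n) T \<in> trees (Suc n)"
proof -
  have "{0..<Suc (m + n) + 1} - ({0..<Suc m + Suc n} - {Suc i - 1..Suc i + Suc n - 1}) = {i..Suc i + n}"
    using assms(2) by auto
  then show ?thesis
    unfolding R_inner_def by (intro delete_leaves_trees[OF assms(1)]) simp
qed

text \<open>With slots counted from 0, slot j of g inserted in slot i of f is slot i + j of the
  composite. Here \<open>R_outer\<close> for slot i and degree n deletes the leaves i + 1, ..., i +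
  n, so the two deleted blocks fuse into one of length n + p.\<close>

lemma R_outer_R_outer_nested:
  assumes "T \<in> trees (Suc (m + n + p))" "i \<le> m" "j \<le> n"
  shows "R_outer (Suc m) (Suc i) (Suc n) (R_outer (Suc (m + n)) (Suc (i + j)) (Suc p) T)
    = R_outer (Suc m) (Suc i) (Suc (n + p)) T"
  unfolding R_outer_def
  by (rule delete_leaves_delete_leaves[OF assms(1), of 0])
    (use assms(2,3) in \<open>auto simp: card_Diff_interval\<close>)

lemma R_inner_R_inner:
  assumes "T \<in> trees (Suc (m + n + p))" "i \<le> m" "j \<le> n"
  shows "R_inner (Suc n) (Suc j) (Suc p) (R_inner (Suc m) (Suc i) (Suc (n + p)) T)
    = R_inner (Suc (m + n)) (Suc (i + j)) (Suc p) T"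
  unfolding R_inner_def
proof (rule delete_leaves_delete_leaves[OF assms(1), of i])
  fix x
  assume x: "x \<le> Suc (m + n + p)"
  show "x \<in> {0..<Suc (m + n) + Suc p} - {Suc (i + j) - 1..Suc (i + j) + Suc p - 1}
    \<longleftrightarrow> x \<in> {0..<Suc m + Suc (n + p)} - {Suc i - 1..Suc i + Suc (n + p) - 1}
      \<or> card ({0..<x} - ({0..<Suc m + Suc (n + p)} - {Suc i - 1..Suc i + Suc (n + p) - 1}))
        \<in> {0..<Suc n + Suc p} - {Suc j - 1..Suc j + Suc p - 1}"
  proof (cases "i \<le> x \<and> x \<le> Suc i + n + p")
    case True
    then show ?thesis using x assms(2,3)
      by (subst card_Diff_compl_interval) auto
  next
    case False
    then show ?thesis using x assms(2,3) by auto
  qed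
qed (use assms(2) in auto)

text \<open>This concerns the tree fed to the middle cochain g: one may first contract the place of
  h and then restrict to the window of g, or first restrict to the window of g composed with h and
  then contract.\<close>

lemma R_inner_R_outer_nested:
  assumes "T \<in> trees (Suc (m + n + p))" "i \<le> m" "j \<le> n"
  shows "R_inner (Suc m) (Suc i) (Suc n) (R_outer (Suc (m + n)) (Suc (i + j)) (Suc p) T)
    = R_outer (Suc n) (Suc j) (Suc p) (R_inner (Suc m) (Suc i) (Suc (n + p)) T)"
  unfolding R_inner_def R_outer_def
proof (rule delete_leaves_comp_eq[OF assms(1), of 0 _ i])
  fix x
  assume x: "x \<le> Suc (m + n + p)"
  show "x \<in> {Suc (i + j)..<Suc (i + j) + Suc p - 1}
      \<or> card ({0..<x} - {Suc (i + j)..<Suc (i + j) + Suc p - 1})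
        \<in> {0..<Suc m + Suc n} - {Suc i - 1..Suc i + Suc n - 1}
    \<longleftrightarrow> x \<in> {0..<Suc m + Suc (n + p)} - {Suc i - 1..Suc i + Suc (n + p) - 1}
      \<or> card ({0..<x} - ({0..<Suc m + Suc (n + p)} - {Suc i - 1..Suc i + Suc (n + p) - 1}))
        \<in> {Suc j..<Suc j + Suc p - 1}"
  \<comment> \<open>Leaves outside the larger window are deleted on both sides. Inside it, the
    restriction renumbers leaf x as x - i.\<close>
  proof (cases "i \<le> x \<and> x \<le> Suc i + n + p")
    case True
    then show ?thesis using x assms(2,3)
      by (subst card_Diff_compl_interval) (auto simp: card_Diff_interval)
  next
    case False
    then show ?thesis using x assms(2,3) by (auto simp: card_Diff_interval)
  qed
qed (use assms(2) in auto)

text \<open>A slot j > i of f becomes slot j + n once g of degree n has filled slot i.\<close>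

lemma R_outer_R_outer_parallel:
  assumes "T \<in> trees (Suc (m + n + p))" "i < j" "j \<le> m"
  shows "R_outer (Suc m) (Suc i) (Suc n) (R_outer (Suc (m + n)) (Suc (j + n)) (Suc p) T)
    = R_outer (Suc m) (Suc j) (Suc p) (R_outer (Suc (m + p)) (Suc i) (Suc n) T)"
  unfolding R_outer_def
  by (rule delete_leaves_comp_eq[OF assms(1), of 0 _ 0])
    (use assms(2,3) in \<open>auto simp: card_Diff_interval\<close>)

lemma R_inner_R_outer_before:
  assumes "T \<in> trees (Suc (m + n + p))" "i < j" "j \<le> m"
  shows "R_inner (Suc m) (Suc i) (Suc n) (R_outer (Suc (m + n)) (Suc (j + n)) (Suc p) T)
    = R_inner (Suc (m + p)) (Suc i) (Suc n) T"
  unfolding R_inner_def R_outer_def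
  by (rule delete_leaves_delete_leaves[OF assms(1), of 0])
    (use assms(2,3) in \<open>auto simp: card_Diff_interval\<close>)

lemma R_inner_R_outer_after:
  assumes "T \<in> trees (Suc (m + n + p))" "i < j" "j \<le> m"
  shows "R_inner (Suc m) (Suc j) (Suc p) (R_outer (Suc (m + p)) (Suc i) (Suc n) T)
    = R_inner (Suc (m + n)) (Suc (j + n)) (Suc p) T"
  unfolding R_inner_def R_outer_def
  by (rule delete_leaves_delete_leaves[OF assms(1), of 0])
    (use assms(2,3) in \<open>auto simp: card_Diff_interval\<close>)

section \<open>The sequential and parallel axioms for partial compositions\<close>

lemma circ_append:
  assumes "T \<in> trees (Suc (m + n))" "length us = i" "length vs = Suc n" "length ws = m - i" "i \<le> m"
  shows "circ (Suc m) (Suc n) (Suc i) f g T (us @ vs @ ws)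
    = f (R_outer (Suc m) (Suc i) (Suc n) T) (us @ g (R_inner (Suc m) (Suc i) (Suc n) T) vs # ws)"
  using assms by (simp add: circ_def)

lemma circ_outside:
  "\<not> (T \<in> trees (Suc (m + n)) \<and> length xs = Suc (m + n)) \<Longrightarrow> circ (Suc m) (Suc n) i f g T xs = 0"
  by (auto simp: circ_def)

lemma split_list_3:
  assumes "length xs = Suc (m + n)" "i \<le> m"
  obtains us vs ws where "xs = us @ vs @ ws" "length us = i" "length vs = Suc n" "length ws = m - i"
proof
  show "xs = take i xs @ take (Suc n) (drop i xs) @ drop (Suc n) (drop i xs)"
    by (simp only: append_take_drop_id)
qed (use assms in auto)

lemma circ_circ_nested:
  assumes i: "i \<le> m" and j: "j \<le> n"
  shows "circ (Suc (m + n)) (Suc p) (Suc (i + j)) (circ (Suc m) (Suc n) (Suc i) f g) h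
    = circ (Suc m) (Suc (n + p)) (Suc i) f (circ (Suc n) (Suc p) (Suc j) g h)"
proof (intro ext)
  fix T xs
  show "circ (Suc (m + n)) (Suc p) (Suc (i + j)) (circ (Suc m) (Suc n) (Suc i) f g) h T xs
    = circ (Suc m) (Suc (n + p)) (Suc i) f (circ (Suc n) (Suc p) (Suc j) g h) T xs"
  proof (cases "T \<in> trees (Suc (m + n + p)) \<and> length xs = Suc (m + n + p)")
    case True
    then have T: "T \<in> trees (Suc (m + n + p))" "T \<in> trees (Suc (m + (n + p)))"
      and len: "length xs = Suc (m + (n + p))" by (simp_all add: add.assoc)
    obtain us vs ws where xs: "xs = us @ vs @ ws"
      and l: "length us = i" "length vs = Suc (n + p)" "length ws = m - i"
      using split_list_3[OF len i] .
    obtain as bs cs where vs: "vs = as @ bs @ cs"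
      and l': "length as = j" "length bs = Suc p" "length cs = n - j"
      using split_list_3[OF l(2) j] .
    have "circ (Suc (m + n)) (Suc p) (Suc (i + j)) (circ (Suc m) (Suc n) (Suc i) f g) h T
        ((us @ as) @ bs @ (cs @ ws))
      = circ (Suc m) (Suc n) (Suc i) f g (R_outer (Suc (m + n)) (Suc (i + j)) (Suc p) T)
        (us @ (as @ h (R_inner (Suc (m + n)) (Suc (i + j)) (Suc p) T) bs # cs) @ ws)"
      using T l l' i j by (subst circ_append) auto
    also have "\<dots> = f (R_outer (Suc m) (Suc i) (Suc (n + p)) T)
        (us @ circ (Suc n) (Suc p) (Suc j) g h (R_inner (Suc m) (Suc i) (Suc (n + p)) T) (as @ bs @ cs) # ws)"
      using T l l' i j
      by (subst circ_append)
        (simp_all add: R_outer_trees R_inner_trees R_outer_R_outer_nested R_inner_R_inner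
          R_inner_R_outer_nested circ_append)
    also have "\<dots> = circ (Suc m) (Suc (n + p)) (Suc i) f (circ (Suc n) (Suc p) (Suc j) g h) T
        (us @ (as @ bs @ cs) @ ws)"
      using T l l' i j by (subst circ_append[of T m "n + p"]) auto
    finally show ?thesis by (simp add: xs vs)
  next
    case False
    then show ?thesis by (simp add: circ_outside add.assoc)
  qed
qed

lemma circ_circ_parallel:
  assumes i: "i < j" and j: "j \<le> m"
  shows "circ (Suc (m + n)) (Suc p) (Suc (j + n)) (circ (Suc m) (Suc n) (Suc i) f g) h
    = circ (Suc (m + p)) (Suc n) (Suc i) (circ (Suc m) (Suc p) (Suc j) f h) g"
proof (intro ext)
  fix T xs
  show "circ (Suc (m + n)) (Suc p) (Suc (j + n)) (circ (Suc m) (Suc n) (Suc i) f g) h T xs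
    = circ (Suc (m + p)) (Suc n) (Suc i) (circ (Suc m) (Suc p) (Suc j) f h) g T xs"
  proof (cases "T \<in> trees (Suc (m + n + p)) \<and> length xs = Suc (m + n + p)")
    case True
    then have T: "T \<in> trees (Suc (m + n + p))" "T \<in> trees (Suc (m + p + n))"
      and len: "length xs = Suc (m + n + p)" by (simp_all add: ac_simps)
    obtain us cs ws where xs: "xs = us @ cs @ ws"
      and l: "length us = j + n" "length cs = Suc p" "length ws = m - j"
      using split_list_3[OF len, of "j + n"] j by auto
    \<comment> \<open>The j + n arguments before the block of h are split like those of a cochain of
      degree j - 1 + n; i < j makes j - 1 a true predecessor.\<close>
    obtain as bs ds where us: "us = as @ bs @ ds"
      and l': "length as = i" "length bs = Suc n" "length ds = j - 1 - i"
      by (rule split_list_3[of us "j - 1" n i]) (use l(1) i in auto)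
    have "circ (Suc (m + n)) (Suc p) (Suc (j + n)) (circ (Suc m) (Suc n) (Suc i) f g) h T
        ((as @ bs @ ds) @ cs @ ws)
      = circ (Suc m) (Suc n) (Suc i) f g (R_outer (Suc (m + n)) (Suc (j + n)) (Suc p) T)
        (as @ bs @ (ds @ h (R_inner (Suc (m + n)) (Suc (j + n)) (Suc p) T) cs # ws))"
      using T l l' i j by (subst circ_append) auto
    also have "\<dots> = f (R_outer (Suc m) (Suc i) (Suc n) (R_outer (Suc (m + n)) (Suc (j + n)) (Suc p) T))
        (as @ g (R_inner (Suc (m + p)) (Suc i) (Suc n) T) bs
          # ds @ h (R_inner (Suc (m + n)) (Suc (j + n)) (Suc p) T) cs # ws)"
      using T l l' i j
      by (subst circ_append) (simp_all add: R_outer_trees R_inner_R_outer_before)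
    also have "\<dots> = circ (Suc m) (Suc p) (Suc j) f h (R_outer (Suc (m + p)) (Suc i) (Suc n) T)
        ((as @ g (R_inner (Suc (m + p)) (Suc i) (Suc n) T) bs # ds) @ cs @ ws)"
      using T l l' i j
      by (subst circ_append) (simp_all add: R_outer_trees R_outer_R_outer_parallel R_inner_R_outer_after)
    also have "\<dots> = circ (Suc (m + p)) (Suc n) (Suc i) (circ (Suc m) (Suc p) (Suc j) f h) g T
        (as @ bs @ (ds @ cs @ ws))"
      using T l l' i j by (subst circ_append) auto
    finally show ?thesis by (simp add: xs us)
  next
    case False
    then show ?thesis by (simp add: circ_outside ac_simps)
  qed
qed

section \<open>The graded pre-Lie algebra of cochains\<close>

lemma linear_intro:
  assumes "vector_space s1" "vector_space s2"
    and "\<And>x y. f (x + y) = f x + f y" "\<And>c x. f (s1 c x) = s2 c (f x)"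
  shows "Vector_Spaces.linear s1 s2 f"
proof -
  interpret vector_space s1 + V2: vector_space s2 by fact+
  show ?thesis by unfold_locales (use assms in auto)
qed

lemma linear_add: "Vector_Spaces.linear s1 s2 f \<Longrightarrow> f (x + y) = f x + f y"
  unfolding Vector_Spaces.linear_def by (blast dest: module_hom.add)

lemma linear_scale: "Vector_Spaces.linear s1 s2 f \<Longrightarrow> f (s1 c x) = s2 c (f x)"
  unfolding Vector_Spaces.linear_def by (blast dest: module_hom.scale)

context
  fixes sD :: "'k::field \<Rightarrow> 'd::ab_group_add \<Rightarrow> 'd" and sE :: "'k \<Rightarrow> 'e::ab_group_add \<Rightarrow> 'e"
begin

lemma cochains_linear:
  assumes "f \<in> cochains sD sE n" "T \<in> trees n" "Suc (length us + length ws) = n"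
  shows "Vector_Spaces.linear sD sE (\<lambda>x. f T (us @ x # ws))"
proof -
  have "\<forall>T\<in>trees n. \<forall>xs. length xs = n \<longrightarrow>
      (\<forall>j<n. Vector_Spaces.linear sD sE (\<lambda>x. f T (xs[j := x])))"
    using assms(1) by (simp add: cochains_def)
  from this[rule_format, of T "us @ undefined # ws" "length us"] show ?thesis
    using assms(2,3) by auto
qed

lemma cochains_add:
  "f \<in> cochains sD sE n \<Longrightarrow> T \<in> trees n \<Longrightarrow> Suc (length us + length ws) = n
    \<Longrightarrow> f T (us @ (x + y) # ws) = f T (us @ x # ws) + f T (us @ y # ws)"
  using linear_add[OF cochains_linear] .

lemma cochains_scale:
  "f \<in> cochains sD sE n \<Longrightarrow> T \<in> trees n \<Longrightarrow> Suc (length us + length ws) = n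
    \<Longrightarrow> f T (us @ sD c x # ws) = sE c (f T (us @ x # ws))"
  using linear_scale[OF cochains_linear] .

lemma cochains_outside:
  "f \<in> cochains sD sE n \<Longrightarrow> \<not> (T \<in> trees n \<and> length xs = n) \<Longrightarrow> f T xs = 0"
  unfolding cochains_def by blast

lemma cochainsI:
  assumes "vector_space sD" "vector_space sE"
    and "\<And>T us ws x y. T \<in> trees n \<Longrightarrow> Suc (length us + length ws) = n
      \<Longrightarrow> f T (us @ (x + y) # ws) = f T (us @ x # ws) + f T (us @ y # ws)"
    and "\<And>T us ws c x. T \<in> trees n \<Longrightarrow> Suc (length us + length ws) = n
      \<Longrightarrow> f T (us @ sD c x # ws) = sE c (f T (us @ x # ws))"
    and "\<And>T xs. \<not> (T \<in> trees n \<and> length xs = n) \<Longrightarrow> f T xs = 0"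
  shows "f \<in> cochains sD sE n"
  unfolding cochains_def
proof (intro CollectI conjI ballI allI impI)
  fix T j and xs :: "'d list"
  assume "T \<in> trees n" "length xs = n" "j < n"
  then show "Vector_Spaces.linear sD sE (\<lambda>x. f T (xs[j := x]))"
    by (intro linear_intro assms(1,2)) (simp_all add: upd_conv_take_nth_drop assms(3,4))
qed (rule assms(5))

end

lemma vector_space_scale_cochain:
  assumes "vector_space s"
  shows "vector_space (scale_cochain s)"
proof -
  interpret vector_space s by fact
  show ?thesis
    by unfold_locales
      (simp_all add: scale_cochain_def fun_eq_iff scale_right_distrib scale_left_distrib)
qed

lemma subspace_cochains:
  assumes sD: "vector_space sD" and sE: "vector_space sE"
  shows "module.subspace (scale_cochain sE) (cochains sD sE n)"
proof -
  interpret D: vector_space sD by fact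
  interpret E: vector_space sE by fact
  interpret F: vector_space "scale_cochain sE" by (rule vector_space_scale_cochain[OF sE])
  show ?thesis
  proof (rule F.subspaceI)
    fix f g assume "f \<in> cochains sD sE n" "g \<in> cochains sD sE n"
    then show "f + g \<in> cochains sD sE n"
      by (intro cochainsI[OF sD sE])
        (simp_all add: cochains_add cochains_scale cochains_outside E.scale_right_distrib)
  next
    fix f c assume "f \<in> cochains sD sE n"
    then show "scale_cochain sE c f \<in> cochains sD sE n"
      by (intro cochainsI[OF sD sE])
        (simp_all add: scale_cochain_def cochains_add cochains_scale cochains_outside
          E.scale_right_distrib mult.commute)
  qed (intro cochainsI[OF sD sE]; simp)
qed

section \<open>Bilinearity and multilinearity of partial compositions\<close>

lemma circ_add_left: "circ m n i (f + f') g = circ m n i f g + circ m n i f' g"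
  by (simp add: circ_def fun_eq_iff)

lemma circ_sum_left: "circ m n i (\<Sum>k\<in>I. f k) g = (\<Sum>k\<in>I. circ m n i (f k) g)"
proof -
  have "circ m n i 0 g = 0" by (simp add: circ_def fun_eq_iff)
  then show ?thesis
    using sum_comp_morphism[of "\<lambda>f. circ m n i f g" f I, OF _ circ_add_left] by (simp add: comp_def)
qed

lemma circ_sgn_left: "circ m n i (sgn_pow k f) g = sgn_pow k (circ m n i f g)"
  by (simp add: circ_def fun_eq_iff sgn_pow_def)

context
  fixes s :: "'k::field_char_0 \<Rightarrow> 'd::ab_group_add \<Rightarrow> 'd"
  assumes vs: "vector_space s"
begin

interpretation D: vector_space s by (fact vs)
interpretation F: vector_space "scale_cochain s" by (rule vector_space_scale_cochain[OF vs])

lemma circ_scale_left: "circ m n i (scale_cochain s c f) g = scale_cochain s c (circ m n i f g)"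
  by (simp add: circ_def fun_eq_iff scale_cochain_def)

lemma circ_add_right:
  assumes "f \<in> cochains s s (Suc m)" "i \<le> m"
  shows "circ (Suc m) (Suc n) (Suc i) f (g + g')
    = circ (Suc m) (Suc n) (Suc i) f g + circ (Suc m) (Suc n) (Suc i) f g'"
  using assms by (auto simp: circ_def fun_eq_iff cochains_add R_outer_trees)

lemma circ_scale_right:
  assumes "f \<in> cochains s s (Suc m)" "i \<le> m"
  shows "circ (Suc m) (Suc n) (Suc i) f (scale_cochain s c g)
    = scale_cochain s c (circ (Suc m) (Suc n) (Suc i) f g)"
  using assms by (auto simp: circ_def fun_eq_iff scale_cochain_def cochains_scale R_outer_trees)

lemma circ_sgn_right:
  assumes "f \<in> cochains s s (Suc m)" "i \<le> m"
  shows "circ (Suc m) (Suc n) (Suc i) f (sgn_pow k g)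
    = sgn_pow k (circ (Suc m) (Suc n) (Suc i) f g)"
  using circ_scale_right[OF assms, where c = "- 1"] by (auto simp: sgn_pow_def)

lemma circ_sum_right:
  assumes "f \<in> cochains s s (Suc m)" "i \<le> m"
  shows "circ (Suc m) (Suc n) (Suc i) f (\<Sum>k\<in>I. g k)
    = (\<Sum>k\<in>I. circ (Suc m) (Suc n) (Suc i) f (g k))"
proof -
  have 0: "circ (Suc m) (Suc n) (Suc i) f 0 = 0"
    using circ_scale_right[OF assms, where c = 0 and g = 0] by simp
  then show ?thesis
    using sum_comp_morphism[of "circ (Suc m) (Suc n) (Suc i) f" g I, OF _ circ_add_right[OF assms]]
    by (simp add: comp_def)
qed

lemma circ_closed:
  assumes f: "f \<in> cochains s s (Suc m)" and g: "g \<in> cochains s s (Suc n)" and i: "i \<le> m"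
  shows "circ (Suc m) (Suc n) (Suc i) f g \<in> cochains s s (Suc (m + n))"
proof -
  let ?c = "circ (Suc m) (Suc n) (Suc i) f g"
  have *: "?c T (us @ (x + y) # ws) = ?c T (us @ x # ws) + ?c T (us @ y # ws) \<and>
      ?c T (us @ s c x # ws) = s c (?c T (us @ x # ws))"
    if T: "T \<in> trees (Suc (m + n))" and l: "Suc (length us + length ws) = Suc (m + n)"
    for T us ws x y c
  proof -
    \<comment> \<open>The varied argument lies before, inside or after the block consumed by g.
      Inside, multilinearity of g and then of f is used; otherwise that of f alone.\<close>
    consider "length us < i" | "i \<le> length us" "length us \<le> i + n" | "i + n < length us"
      by linarith
    then show ?thesis
    proof cases
      case 1
      let ?p = "take (i - Suc (length us)) ws" and ?q = "take (Suc n) (drop (i - Suc (length us)) ws)"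
        and ?r = "drop (Suc n) (drop (i - Suc (length us)) ws)"
      have "us @ z # ws = (us @ z # ?p) @ ?q @ ?r" for z
        by (simp only: append_assoc append_Cons append_take_drop_id)
      moreover have "?c T ((us @ z # ?p) @ ?q @ ?r) = f (R_outer (Suc m) (Suc i) (Suc n) T)
          ((us @ z # ?p) @ g (R_inner (Suc m) (Suc i) (Suc n) T) ?q # ?r)" for z
        by (rule circ_append[OF T]) (use 1 l i in auto)
      ultimately have "?c T (us @ z # ws) = f (R_outer (Suc m) (Suc i) (Suc n) T)
          (us @ z # (?p @ g (R_inner (Suc m) (Suc i) (Suc n) T) ?q # ?r))" for z
        by (simp only: append_assoc append_Cons)
      moreover have "Suc (length us + length (?p @ g (R_inner (Suc m) (Suc i) (Suc n) T) ?q # ?r)) = Suc m"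
        using 1 l i by simp
      ultimately show ?thesis
        using f R_outer_trees[OF T i] by (simp only: cochains_add cochains_scale)
    next
      case 2
      let ?p = "take i us" and ?q = "drop i us" and ?r = "take (Suc n - Suc (length us - i)) ws"
        and ?t = "drop (Suc n - Suc (length us - i)) ws"
      have "us @ z # ws = ?p @ (?q @ z # ?r) @ ?t" for z by simp
      moreover have "?c T (?p @ (?q @ z # ?r) @ ?t) = f (R_outer (Suc m) (Suc i) (Suc n) T)
          (?p @ g (R_inner (Suc m) (Suc i) (Suc n) T) (?q @ z # ?r) # ?t)" for z
        by (rule circ_append[OF T]) (use 2 l i in auto)
      ultimately have "?c T (us @ z # ws) = f (R_outer (Suc m) (Suc i) (Suc n) T)
          (?p @ g (R_inner (Suc m) (Suc i) (Suc n) T) (?q @ z # ?r) # ?t)" for z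
        by (simp only:)
      moreover have "Suc (length ?q + length ?r) = Suc n" "Suc (length ?p + length ?t) = Suc m"
        using 2 l i by simp_all
      ultimately show ?thesis
        using f g R_outer_trees[OF T i] R_inner_trees[OF T i]
        by (simp only: cochains_add cochains_scale)
    next
      case 3
      let ?p = "take i us" and ?q = "take (Suc n) (drop i us)" and ?r = "drop (Suc n) (drop i us)"
      have us: "?p @ ?q @ ?r = us" by (simp only: append_take_drop_id)
      have "us @ z # ws = ?p @ ?q @ (?r @ z # ws)" for z
        using us by (metis append_assoc)
      moreover have "?c T (?p @ ?q @ (?r @ z # ws)) = f (R_outer (Suc m) (Suc i) (Suc n) T)
          (?p @ g (R_inner (Suc m) (Suc i) (Suc n) T) ?q # (?r @ z # ws))" for z
        by (rule circ_append[OF T]) (use 3 l i in auto)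
      ultimately have "?c T (us @ z # ws) = f (R_outer (Suc m) (Suc i) (Suc n) T)
          ((?p @ g (R_inner (Suc m) (Suc i) (Suc n) T) ?q # ?r) @ z # ws)" for z
        by (simp only: append_assoc append_Cons)
      moreover have "Suc (length (?p @ g (R_inner (Suc m) (Suc i) (Suc n) T) ?q # ?r) + length ws) = Suc m"
        using 3 l i by simp
      ultimately show ?thesis
        using f R_outer_trees[OF T i] by (simp only: cochains_add cochains_scale)
    qed
  qed
  show ?thesis
    by (rule cochainsI[OF vs vs]) (use * circ_outside in \<open>blast+\<close>)
qed

end

section \<open>The pre-Lie product of cochains\<close>

definition pre_lie :: "nat \<Rightarrow> nat \<Rightarrow> ('d, 'd::ab_group_add) cochain \<Rightarrow> ('d, 'd) cochain \<Rightarrow> ('d, 'd) cochain"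
  where "pre_lie m n f g = (\<Sum>i\<le>m. sgn_pow (i * n) (circ (Suc m) (Suc n) (Suc i) f g))"

text \<open>These are the slots of a composite in which slot i of a cochain of degree m is filled by
  one of degree n: the slots before the inserted block, the n + 1 slots of the block, and those
  after it, shifted by n.\<close>

lemma sum_atMost_split:
  fixes F :: "nat \<Rightarrow> 'v::ab_group_add"
  assumes "i \<le> m"
  shows "(\<Sum>k\<le>m + n. F k) = (\<Sum>k<i. F k) + (\<Sum>j\<le>n. F (i + j)) + (\<Sum>j\<in>{i<..m}. F (j + n))"
proof -
  have "{..m + n} = {..<i} \<union> ({i..i + n} \<union> {i + n<..m + n})" using assms by auto
  then have "(\<Sum>k\<le>m + n. F k) = sum F ({..<i} \<union> ({i..i + n} \<union> {i + n<..m + n}))" by simp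
  also have "\<dots> = (\<Sum>k<i. F k) + (sum F {i..i + n} + sum F {i + n<..m + n})"
    by (subst sum.union_disjoint; (subst sum.union_disjoint)?) auto
  also have "sum F {i..i + n} = (\<Sum>j\<le>n. F (i + j))"
    by (rule sum.reindex_bij_witness[of _ "\<lambda>j. i + j" "\<lambda>k. k - i"]) auto
  also have "sum F {i + n<..m + n} = (\<Sum>j\<in>{i<..m}. F (j + n))"
    by (rule sum.reindex_bij_witness[of _ "\<lambda>j. j + n" "\<lambda>k. k - n"]) auto
  finally show ?thesis by (simp add: add.assoc)
qed

lemma sum_triangle_swap:
  "(\<Sum>i\<le>m. \<Sum>k<i. F i k) = (\<Sum>k\<le>m::nat. \<Sum>i\<in>{k<..m}. F i k)"
  by (subst sum.Sigma; (subst sum.Sigma)?)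
    (auto intro!: sum.reindex_bij_witness[of _ "\<lambda>(k, i). (i, k)" "\<lambda>(i, k). (k, i)"])

text \<open>This is Gerstenhaber's argument. Terms with h inserted in g cancel by the sequential
  axiom, so g and h remain in distinct slots of f. By the parallel axiom, h to the right of g is the
  same as g to the left of h, so exchanging g and h permutes the two halves up to the sign (-1)^(n
  p).\<close>

lemma pre_lie_associator:
  assumes vs: "vector_space (s :: 'k::field_char_0 \<Rightarrow> 'd::ab_group_add \<Rightarrow> 'd)"
    and f: "f \<in> cochains s s (Suc m)"
  shows "pre_lie (m + n) p (pre_lie m n f g) h - pre_lie m (n + p) f (pre_lie n p g h)
    = sgn_pow (n * p) (pre_lie (m + p) n (pre_lie m p f h) g - pre_lie m (p + n) f (pre_lie p n h g))"
proof -
  \<comment> \<open>\<open>X n p g h\<close> collects the placements of h strictly to the left of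
    g.\<close>
  define X where "X n p g h = (\<Sum>i\<le>m. \<Sum>k<i. sgn_pow (k * p + i * n)
      (circ (Suc (m + n)) (Suc p) (Suc k) (circ (Suc m) (Suc n) (Suc i) f g) h))"
    for n p and g h :: "('d, 'd) cochain"
  have *: "pre_lie (m + n) p (pre_lie m n f g) h - pre_lie m (n + p) f (pre_lie n p g h)
      = X n p g h + sgn_pow (n * p) (X p n h g)" for n p and g h :: "('d, 'd) cochain"
  proof -
    define F where "F i k = circ (Suc (m + n)) (Suc p) (Suc k) (circ (Suc m) (Suc n) (Suc i) f g) h" for i k
    have "pre_lie (m + n) p (pre_lie m n f g) h
        = (\<Sum>k\<le>m + n. \<Sum>i\<le>m. sgn_pow (k * p + i * n) (F i k))"
      by (simp add: pre_lie_def circ_sum_left circ_sgn_left sgn_pow_sum sgn_pow_sgn_pow F_def)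
    also have "\<dots> = (\<Sum>i\<le>m. \<Sum>k\<le>m + n. sgn_pow (k * p + i * n) (F i k))"
      by (rule sum.swap)
    also have "\<dots> = (\<Sum>i\<le>m. (\<Sum>k<i. sgn_pow (k * p + i * n) (F i k))
        + (\<Sum>j\<le>n. sgn_pow ((i + j) * p + i * n) (F i (i + j)))
        + (\<Sum>j\<in>{i<..m}. sgn_pow ((j + n) * p + i * n) (F i (j + n))))"
      by (intro sum.cong refl sum_atMost_split) simp
    finally have L: "pre_lie (m + n) p (pre_lie m n f g) h = X n p g h
        + (\<Sum>i\<le>m. \<Sum>j\<le>n. sgn_pow ((i + j) * p + i * n) (F i (i + j)))
        + (\<Sum>i\<le>m. \<Sum>j\<in>{i<..m}. sgn_pow ((j + n) * p + i * n) (F i (j + n)))"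
      by (simp add: sum.distrib X_def F_def)
    have "pre_lie m (n + p) f (pre_lie n p g h)
        = (\<Sum>i\<le>m. \<Sum>j\<le>n. sgn_pow (i * (n + p) + j * p) (F i (i + j)))"
      using f by (simp add: pre_lie_def circ_sum_right[OF vs] circ_sgn_right[OF vs] sgn_pow_sum
          sgn_pow_sgn_pow F_def circ_circ_nested)
    also have "\<dots> = (\<Sum>i\<le>m. \<Sum>j\<le>n. sgn_pow ((i + j) * p + i * n) (F i (i + j)))"
      by (simp add: algebra_simps)
    finally have R: "pre_lie m (n + p) f (pre_lie n p g h) = \<dots>" .
    have "X p n h g = (\<Sum>i\<le>m. \<Sum>k<i. sgn_pow (k * n + i * p) (F k (i + n)))"
      unfolding X_def F_def by (intro sum.cong refl arg_cong[of _ _ "sgn_pow _"])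
        (simp add: circ_circ_parallel)
    also have "\<dots> = (\<Sum>k\<le>m. \<Sum>i\<in>{k<..m}. sgn_pow (k * n + i * p) (F k (i + n)))"
      by (rule sum_triangle_swap)
    finally have "sgn_pow (n * p) (X p n h g)
        = (\<Sum>i\<le>m. \<Sum>j\<in>{i<..m}. sgn_pow ((j + n) * p + i * n) (F i (j + n)))"
      by (simp add: sgn_pow_sum sgn_pow_sgn_pow algebra_simps)
    with L R show ?thesis by simp
  qed
  show ?thesis
    unfolding * by (simp add: sgn_pow_add sgn_pow_sgn_pow mult.commute)
      (simp add: sgn_pow_def add.commute)
qed

lemma graded_pre_lie_cochains:
  assumes vs: "vector_space (s :: 'k::field_char_0 \<Rightarrow> 'd::ab_group_add \<Rightarrow> 'd)"
  shows "graded_pre_lie (scale_cochain s) (\<lambda>n. cochains s s (Suc n)) pre_lie"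
proof -
  interpret D: vector_space s by fact
  interpret F: vector_space "scale_cochain s" by (rule vector_space_scale_cochain[OF vs])
  have sub: "F.subspace (cochains s s (Suc n))" for n by (rule subspace_cochains[OF vs vs])
  have scale_sgn: "scale_cochain s c (sgn_pow k f) = sgn_pow k (scale_cochain s c f)" for c k f
    by (simp add: sgn_pow_def)
  show ?thesis
  proof
    show "F.subspace (cochains s s (Suc n))" for n by (rule sub)
    show "pre_lie m n f g \<in> cochains s s (Suc (m + n))"
      if "f \<in> cochains s s (Suc m)" "g \<in> cochains s s (Suc n)" for f g m n
      unfolding pre_lie_def using circ_closed[OF vs that] F.subspace_neg[OF sub]
      by (intro F.subspace_sum[OF sub]) (simp add: sgn_pow_def)
  qed (auto simp: pre_lie_def circ_add_left circ_add_right[OF vs] circ_scale_left[OF vs]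
      circ_scale_right[OF vs] sgn_pow_add sum.distrib scale_sgn F.scale_sum_right
      intro: pre_lie_associator[OF vs, unfolded pre_lie_def])
qed

section \<open>Extension by zero\<close>

lemma leaves_eq_1: "reduced T \<Longrightarrow> leaves T = Suc 0 \<longleftrightarrow> T = Leaf"
proof (cases T)
  case (Node ts)
  assume r: "reduced T"
  then obtain a b us where "ts = a # b # us" "reduced a" "reduced b"
    using Node by (cases ts rule: remdups_adj.cases) auto
  then show ?thesis using Node leaves_pos[of a] leaves_pos[of b] by simp
qed simp

text \<open>Four children already account for four leaves, so these cases suffice to list the trees
  up to \<open>trees 3\<close>.\<close>

lemma reduced_Node_cases:
  assumes "reduced (Node ts)"
  obtains a b where "ts = [a, b]" "reduced a" "reduced b" "0 < leaves a" "0 < leaves b"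
  | a b c where "ts = [a, b, c]" "reduced a" "reduced b" "reduced c"
    "0 < leaves a" "0 < leaves b" "0 < leaves c"
  | a b c d us where "ts = a # b # c # d # us" "reduced a" "reduced b" "reduced c" "reduced d"
    "0 < leaves a" "0 < leaves b" "0 < leaves c" "0 < leaves d" "\<forall>u\<in>set us. reduced u \<and> 0 < leaves u"
proof -
  have r: "2 \<le> length ts" "\<forall>t\<in>set ts. reduced t \<and> 0 < leaves t"
    using assms leaves_pos by auto
  show ?thesis
  proof (cases ts)
    case (Cons a ts1)
    then obtain b ts2 where ts1: "ts1 = b # ts2" using r by (cases ts1) auto
    show ?thesis
    proof (cases ts2)
      case Nil
      then show ?thesis using that(1) r Cons ts1 by simp
    next
      case (Cons c ts3)
      then show ?thesis using that(2,3) r \<open>ts = a # ts1\<close> ts1 by (cases ts3) auto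
    qed
  qed (use r in simp)
qed

lemma trees_1: "T \<in> trees (Suc 0) \<Longrightarrow> T = Node [Leaf, Leaf]"
proof (cases T)
  case (Node ts)
  assume T: "T \<in> trees (Suc 0)"
  then have "reduced (Node ts)" by (simp add: trees_def Node)
  then show ?thesis
  proof (cases rule: reduced_Node_cases)
    case (1 a b)
    then have "leaves a = Suc 0 \<and> leaves b = Suc 0"
      using T by (auto simp: trees_def Node)
    then show ?thesis using 1 by (simp add: Node leaves_eq_1)
  qed (use T in \<open>auto simp: trees_def Node\<close>)
qed (simp add: trees_def)

lemma trees_2: "T \<in> trees 2 \<Longrightarrow> T = T_left \<or> T = T_right \<or> T = T_perp"
proof (cases T)
  case (Node ts)
  assume T: "T \<in> trees 2"
  then have "reduced (Node ts)" by (simp add: trees_def Node)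
  then show ?thesis
  proof (cases rule: reduced_Node_cases)
    case (1 a b)
    then have "leaves a = Suc 0 \<and> leaves b = Suc (Suc 0) \<or> leaves a = Suc (Suc 0) \<and> leaves b = Suc 0"
      using T by (auto simp: trees_def Node)
    then show ?thesis
      using 1 trees_1[of a] trees_1[of b]
      by (auto simp: trees_def Node leaves_eq_1 T_left_def T_right_def)
  next
    case (2 a b c)
    then have "leaves a = Suc 0 \<and> leaves b = Suc 0 \<and> leaves c = Suc 0"
      using T by (auto simp: trees_def Node)
    then show ?thesis using 2 by (simp add: Node leaves_eq_1 T_perp_def)
  next
    case (3 a b c d us)
    then show ?thesis using T by (auto simp: trees_def Node)
  qed
qed (simp add: trees_def)

text \<open>Counting by the children of the root: with two children, six trees pair
  \<open>Leaf\<close> with an element of \<open>trees 2\<close> and one has two leaves over each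
  child; three children give three trees and four children give one, eleven in all.\<close>

lemma trees_3:
  assumes T: "T \<in> trees 3"
  shows "(\<exists>t\<in>{T_left, T_right, T_perp}. T = Node [Leaf, t] \<or> T = Node [t, Leaf])
    \<or> T = Node [Node [Leaf, Leaf], Node [Leaf, Leaf]]
    \<or> T = Node [Node [Leaf, Leaf], Leaf, Leaf] \<or> T = Node [Leaf, Node [Leaf, Leaf], Leaf]
    \<or> T = Node [Leaf, Leaf, Node [Leaf, Leaf]] \<or> T = Node [Leaf, Leaf, Leaf, Leaf]"
proof (cases T)
  case (Node ts)
  then have "reduced (Node ts)" using T by (simp add: trees_def)
  then show ?thesis
  proof (cases rule: reduced_Node_cases)
    case (1 a b)
    then have "leaves a = Suc 0 \<and> leaves b = 2 + 1 \<or> leaves a = 2 + 1 \<and> leaves b = Suc 0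
        \<or> leaves a = Suc (Suc 0) \<and> leaves b = Suc (Suc 0)"
      using T by (auto simp: trees_def Node)
    then show ?thesis
      using 1 trees_1[of a] trees_1[of b] trees_2[of a] trees_2[of b]
      by (auto simp: trees_def Node leaves_eq_1)
  next
    case (2 a b c)
    then have "leaves a = Suc 0 \<and> leaves b = Suc 0 \<and> leaves c = Suc (Suc 0)
        \<or> leaves a = Suc 0 \<and> leaves b = Suc (Suc 0) \<and> leaves c = Suc 0
        \<or> leaves a = Suc (Suc 0) \<and> leaves b = Suc 0 \<and> leaves c = Suc 0"
      using T by (auto simp: trees_def Node)
    then show ?thesis
      using 2 trees_1[of a] trees_1[of b] trees_1[of c] by (auto simp: trees_def Node leaves_eq_1)
  next
    case (3 a b c d us)
    then have "leaves a = Suc 0 \<and> leaves b = Suc 0 \<and> leaves c = Suc 0 \<and> leaves d = Suc 0 \<and> us = []"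
      using T by (cases us) (auto simp: trees_def Node)
    then show ?thesis using 3 by (simp add: Node leaves_eq_1)
  qed
qed (use T in \<open>simp add: trees_def\<close>)

section \<open>The image of extension by zero\<close>

lemma range_ext_iff:
  "F \<in> range ext \<longleftrightarrow> (\<forall>T xs. snd (F T xs) = 0) \<and> (\<forall>T xs ys. map snd xs = map snd ys \<longrightarrow> F T xs = F T ys)"
proof (intro iffI conjI)
  assume F: "(\<forall>T xs. snd (F T xs) = 0) \<and> (\<forall>T xs ys. map snd xs = map snd ys \<longrightarrow> F T xs = F T ys)"
  \<comment> \<open>A preimage is read off at arguments with zero A-component. Multilinearity is a
    separate matter, since \<open>range ext\<close> runs over arbitrary functions.\<close>
  have "F = ext (\<lambda>T ys. fst (F T (map (Pair 0) ys)))"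
  proof (intro HOL.ext)
    fix T xs
    have "F T xs = F T (map (Pair 0) (map snd xs))"
      by (rule F[THEN conjunct2, rule_format]) (simp add: comp_def)
    moreover have "snd (F T xs) = 0" using F by blast
    ultimately show "F T xs = ext (\<lambda>T ys. fst (F T (map (Pair 0) ys))) T xs"
      unfolding ext_def by (metis prod.collapse)
  qed
  then show "F \<in> range ext" by blast
qed (auto simp: ext_def)

lemma ext_add: "ext (f + g) = ext f + (ext g :: ('a::ab_group_add \<times> 'b::ab_group_add, _) cochain)"
  by (simp add: ext_def fun_eq_iff)

lemma ext_minus: "ext (- f) = - (ext f :: ('a::ab_group_add \<times> 'b::ab_group_add, _) cochain)"
  by (simp add: ext_def fun_eq_iff)

lemma ext_zero: "ext (0 :: ('b::ab_group_add, 'a::ab_group_add) cochain) = 0"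
  by (simp add: ext_def fun_eq_iff zero_prod_def)

lemma ext_sgn_pow:
  "ext (sgn_pow k f) = sgn_pow k (ext f :: ('a::ab_group_add \<times> 'b::ab_group_add, _) cochain)"
  by (simp add: sgn_pow_def ext_minus)

lemma inj_ext: "inj (ext :: ('b::ab_group_add, 'a::ab_group_add) cochain \<Rightarrow> _)"
proof (rule injI, intro HOL.ext)
  fix f g :: "('b, 'a) cochain" and T xs
  assume "ext f = ext g"
  then have "ext f T (map (Pair 0) xs) = ext g T (map (Pair 0) xs)" by simp
  then show "f T xs = g T xs" by (simp add: ext_def comp_def)
qed

lemma range_ext_add: "F \<in> range ext \<Longrightarrow> G \<in> range ext
    \<Longrightarrow> F + G \<in> range (ext :: ('b::ab_group_add, 'a::ab_group_add) cochain \<Rightarrow> _)"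
  by (auto simp flip: ext_add)

lemma range_ext_minus: "F \<in> range ext
    \<Longrightarrow> - F \<in> range (ext :: ('b::ab_group_add, 'a::ab_group_add) cochain \<Rightarrow> _)"
  by (auto simp flip: ext_minus)

lemma range_ext_sgn_pow: "F \<in> range ext
    \<Longrightarrow> sgn_pow k F \<in> range (ext :: ('b::ab_group_add, 'a::ab_group_add) cochain \<Rightarrow> _)"
  by (auto simp flip: ext_sgn_pow)

lemma range_ext_zero: "0 \<in> range (ext :: ('b::ab_group_add, 'a::ab_group_add) cochain \<Rightarrow> _)"
  by (rule range_eqI[where x = 0]) (simp add: ext_zero)

lemma range_ext_sum: "(\<And>i. i \<in> I \<Longrightarrow> F i \<in> range ext)
    \<Longrightarrow> sum F I \<in> range (ext :: ('b::ab_group_add, 'a::ab_group_add) cochain \<Rightarrow> _)"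
  by (induction I rule: infinite_finite_induct) (auto intro: range_ext_add range_ext_zero)

lemma pre_lie_range_ext:
  fixes f g :: "('a::ab_group_add \<times> 'b::ab_group_add, 'a \<times> 'b) cochain"
  assumes "\<And>i. i \<le> m \<Longrightarrow> circ (Suc m) (Suc n) (Suc i) f g \<in> range ext"
  shows "pre_lie m n f g \<in> range ext"
  unfolding pre_lie_def using assms by (intro range_ext_sum range_ext_sgn_pow) simp

text \<open>Starting the summation at 0 turns the exponent (i - 1)(n - 1) for arities into i n for
  degrees.\<close>

lemma gbracket_pre_lie:
  "gbracket (Suc m) (Suc n) f g = pre_lie m n f g - sgn_pow (m * n) (pre_lie n m g f)"
  by (simp add: gbracket_def pre_lie_def sum.atLeast1_atMost_eq lessThan_Suc_atMost
      del: sum.lessThan_Suc sum.atMost_Suc sum.cl_ivl_Suc)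

definition prod_scale :: "('k \<Rightarrow> 'a \<Rightarrow> 'a) \<Rightarrow> ('k \<Rightarrow> 'b \<Rightarrow> 'b) \<Rightarrow> 'k \<Rightarrow> 'a \<times> 'b \<Rightarrow> 'a \<times> 'b" where
  "prod_scale sA sB c p = (sA c (fst p), sB c (snd p))"

lemma vector_space_prod_scale:
  assumes "vector_space sA" "vector_space sB"
  shows "vector_space (prod_scale sA sB)"
proof -
  interpret A: vector_space sA by fact
  interpret B: vector_space sB by fact
  show ?thesis
    by unfold_locales
      (simp_all add: prod_scale_def prod_eq_iff A.scale_right_distrib A.scale_left_distrib
        B.scale_right_distrib B.scale_left_distrib)
qed

lemma linear_zero: "Vector_Spaces.linear s1 s2 f \<Longrightarrow> f 0 = 0"
  using linear_add[of s1 s2 f 0 0] by simp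

locale bimodule_char_0 = assoc_bimodule sA sB lact ract
  for sA :: "'k::field_char_0 \<Rightarrow> 'a::ring \<Rightarrow> 'a"
    and sB :: "'k \<Rightarrow> 'b::ring \<Rightarrow> 'b"
    and lact :: "'a \<Rightarrow> 'b \<Rightarrow> 'b" and ract :: "'b \<Rightarrow> 'a \<Rightarrow> 'b"
begin

abbreviation "sD \<equiv> prod_scale sA sB"
abbreviation "\<pi> \<equiv> pi_cochain sB lact ract"

lemmas vsA = A.vector_space_axioms
lemmas vsB = B.vector_space_axioms
lemmas vsD = vector_space_prod_scale[OF vsA vsB]

sublocale G: graded_pre_lie "scale_cochain sD" "\<lambda>n. cochains sD sD (Suc n)" pre_lie
  by (rule graded_pre_lie_cochains[OF vsD])

lemmas action_add [simp] =
  linear_add[OF lact_linear_alg] linear_add[OF lact_linear_mod]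
  linear_add[OF ract_linear_alg] linear_add[OF ract_linear_mod]

lemmas action_scale [simp] =
  linear_scale[OF lact_linear_alg] linear_scale[OF lact_linear_mod]
  linear_scale[OF ract_linear_alg] linear_scale[OF ract_linear_mod]

lemmas action_zero [simp] =
  linear_zero[OF lact_linear_alg] linear_zero[OF lact_linear_mod]
  linear_zero[OF ract_linear_alg] linear_zero[OF ract_linear_mod]

end

section \<open>The Maurer-Cartan equation\<close>

lemma sum_fun_apply: "(\<Sum>i\<in>I. F i) x = (\<Sum>i\<in>I. F i x)"
  using sum_comp_morphism[of "\<lambda>f. f x" F I] by (simp add: comp_def)

lemma pre_lie_apply:
  "pre_lie m n f g T xs = (\<Sum>i\<le>m. sgn_pow (i * n) (circ (Suc m) (Suc n) (Suc i) f g T xs))"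
  unfolding pre_lie_def sum_fun_apply by (intro sum.cong refl) (simp add: sgn_pow_def)

lemma pre_lie_outside:
  "\<not> (T \<in> trees (Suc (m + n)) \<and> length xs = Suc (m + n)) \<Longrightarrow> pre_lie m n f g T xs = 0"
  unfolding pre_lie_apply by (intro sum.neutral) (simp add: circ_outside)

text \<open>On four leaves every outer and inner tree arises by deleting one leaf; the second slot
  carries the sign -1 because both degrees are one.\<close>

lemma pre_lie_1_1:
  assumes "T \<in> trees 3"
  shows "pre_lie (Suc 0) (Suc 0) f g T [p, q, r] =
    f (delete_leaves {1} T) [g (delete_leaves {3} T) [p, q], r]
    - f (delete_leaves {2} T) [p, g (delete_leaves {0} T) [q, r]]"
proof -
  have T: "T \<in> trees (Suc (Suc 0 + Suc 0))" using assms by (simp add: numeral_3_eq_3)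
  have "pre_lie (Suc 0) (Suc 0) f g
      = circ (Suc (Suc 0)) (Suc (Suc 0)) (Suc 0) f g - circ (Suc (Suc 0)) (Suc (Suc 0)) (Suc (Suc 0)) f g"
    by (simp add: pre_lie_def sgn_pow_def)
  moreover have "{0..<4} - {0..2} = {3::nat}" "{0..<4} - {1..3} = {0::nat}"
    "{1..<2} = {1::nat}" "{2..<3} = {2::nat}" by auto
  ultimately show ?thesis
    using circ_append[OF T, of "[]" 0 "[p, q]" "[r]" f g] circ_append[OF T, of "[p]" "Suc 0" "[q, r]" "[]" f g]
    by (simp add: R_outer_def R_inner_def numeral_eq_Suc)
qed

context bimodule_char_0
begin

lemma pi_add:
  "\<pi> c T [p + q, r] = \<pi> c T [p, r] + \<pi> c T [q, r]"
  "\<pi> c T [r, p + q] = \<pi> c T [r, p] + \<pi> c T [r, q]"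
  by (cases p; cases q; cases r; simp add: pi_cochain_def distrib_left distrib_right B.scale_right_distrib)+

lemma pi_scale:
  "\<pi> c T [sD k p, r] = sD k (\<pi> c T [p, r])"
  "\<pi> c T [r, sD k p] = sD k (\<pi> c T [r, p])"
  subgoal by (cases p; cases r; simp add: pi_cochain_def prod_scale_def zero_prod_def A.scale_mult_left
      B.scale_mult_left mult.commute)
  subgoal by (cases p; cases r; simp add: pi_cochain_def prod_scale_def zero_prod_def A.scale_mult_right
      B.scale_mult_right mult.commute)
  done

lemma pi_closed: "\<pi> c \<in> cochains sD sD (Suc (Suc 0))"
proof (rule cochainsI[OF vsD vsD])
  fix T and us ws :: "('a \<times> 'b) list" and p q and k :: 'k
  assume "T \<in> trees (Suc (Suc 0))" "Suc (length us + length ws) = Suc (Suc 0)"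
  then have "us = [] \<and> (\<exists>r. ws = [r]) \<or> ws = [] \<and> (\<exists>r. us = [r])"
    by (cases us; cases ws) auto
  then show "\<pi> c T (us @ (p + q) # ws) = \<pi> c T (us @ p # ws) + \<pi> c T (us @ q # ws)"
    and "\<pi> c T (us @ sD k p # ws) = sD k (\<pi> c T (us @ p # ws))"
    by (auto simp: pi_add pi_scale)
next
  fix T and xs :: "('a \<times> 'b) list"
  assume "\<not> (T \<in> trees (Suc (Suc 0)) \<and> length xs = Suc (Suc 0))"
  then show "\<pi> c T xs = 0"
    by (auto simp: pi_cochain_def trees_def T_left_def T_right_def T_perp_def split: list.splits)
qed

text \<open>On each of the eleven trees, the two ways to associate three factors are compared, with
  the four products prescribed by the faces of the tree; the identities needed are associativity and
  the bimodule axioms. For distinct scalars one pre-Lie product alone need not vanish: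
  \<open>Node [Node [Leaf, Leaf], Leaf, Leaf]\<close> gives the B-component c (a \<cdot> y) z - d a
  \<cdot> (y z), which cancels only against the term with c and d exchanged.\<close>

lemma pi_pi: "G.br (Suc 0) (Suc 0) (\<pi> c) (\<pi> d) = 0"
proof -
  have br: "G.br (Suc 0) (Suc 0) f g T xs
      = pre_lie (Suc 0) (Suc 0) f g T xs + pre_lie (Suc 0) (Suc 0) g f T xs" for f g T xs
    by (simp add: G.br_def sgn_pow_def)
  have "pre_lie (Suc 0) (Suc 0) (\<pi> c) (\<pi> d) T xs + pre_lie (Suc 0) (Suc 0) (\<pi> d) (\<pi> c) T xs = 0" for T xs
  proof (cases "T \<in> trees 3 \<and> length xs = 3")
    case True
    then obtain a x b y e z where xs: "xs = [(a, x), (b, y), (e, z)]"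
      by (auto simp: length_Suc_conv numeral_3_eq_3)
    show ?thesis
      using trees_3[OF conjunct1[OF True]] unfolding xs pre_lie_1_1[OF conjunct1[OF True]]
      by (elim conjE disjE bexE insertE emptyE)
        (simp_all add: zero_prod_def delete_leaves_def T_left_def T_right_def T_perp_def
        pi_cochain_def mult.assoc lact_lact lact_ract ract_ract ract_mult mult_middle lact_mult
        B.scale_mult_left B.scale_mult_right mult.commute)
  next
    case False
    then show ?thesis
      by (simp add: pre_lie_outside numeral_3_eq_3)
  qed
  then show ?thesis by (intro HOL.ext) (simp add: br)
qed
end

section \<open>The differential graded Lie algebra\<close>

lemma cochains_zero_mem:
  assumes f: "f \<in> cochains s1 s2 n" and vs: "vector_space s1" "vector_space s2" and "0 \<in> set xs"
  shows "f T xs = 0"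
proof (cases "T \<in> trees n \<and> length xs = n")
  case True
  interpret V1: vector_space s1 by fact
  interpret V2: vector_space s2 by fact
  obtain us ws where "xs = us @ 0 # ws" using assms(4) by (meson split_list)
  then show ?thesis using cochains_scale[OF f, of T us ws 0 0] True by simp
qed (use cochains_outside[OF f] in blast)

context bimodule_char_0
begin

lemma ext_closed_iff: "(ext f :: ('a \<times> 'b, 'a \<times> 'b) cochain) \<in> cochains sD sD n \<longleftrightarrow> f \<in> cochains sB sA n"
proof
  assume f: "f \<in> cochains sB sA n"
  show "ext f \<in> cochains sD sD n"
  proof (rule cochainsI[OF vsD vsD])
    fix T and xs :: "('a \<times> 'b) list"
    assume "\<not> (T \<in> trees n \<and> length xs = n)"
    then have "f T (map snd xs) = 0" by (intro cochains_outside[OF f]) simp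
    then show "ext f T xs = 0" by (simp add: ext_def zero_prod_def)
  qed (use f in \<open>auto simp: ext_def prod_scale_def cochains_add cochains_scale\<close>)
next
  assume F: "ext f \<in> cochains sD sD n"
  show "f \<in> cochains sB sA n"
  proof (rule cochainsI[OF vsB vsA])
    fix T and us ws :: "'b list" and x y and c :: 'k
    assume "T \<in> trees n" "Suc (length us + length ws) = n"
    then have "ext f T (map (Pair 0) us @ ((0, x) + (0, y)) # map (Pair 0) ws) =
        ext f T (map (Pair 0) us @ (0, x) # map (Pair 0) ws)
        + ext f T (map (Pair 0) us @ (0, y) # map (Pair 0) ws)"
      and "ext f T (map (Pair 0) us @ sD c (0, x) # map (Pair 0) ws) =
        sD c (ext f T (map (Pair 0) us @ (0, x) # map (Pair 0) ws))"
      by (intro cochains_add[OF F] cochains_scale[OF F]; simp)+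
    moreover have "f T (us @ z # ws) = fst (ext f T (map (Pair 0) us @ (0, z) # map (Pair 0) ws))" for z
      by (simp add: ext_def comp_def)
    ultimately show "f T (us @ (x + y) # ws) = f T (us @ x # ws) + f T (us @ y # ws)"
      and "f T (us @ sB c x # ws) = sA c (f T (us @ x # ws))"
      by (simp_all add: prod_scale_def)
  next
    fix T and xs :: "'b list"
    assume "\<not> (T \<in> trees n \<and> length xs = n)"
    then have "ext f T (map (Pair 0) xs) = 0" by (intro cochains_outside[OF F]) simp
    moreover have "f T xs = fst (ext f T (map (Pair 0) xs))"
      by (simp add: ext_def comp_def)
    ultimately show "f T xs = 0" by simp
  qed
qed

lemma ext_scale: "ext (scale_cochain sA c f) = scale_cochain sD c (ext f)"
  by (simp add: ext_def scale_cochain_def prod_scale_def fun_eq_iff)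

text \<open>An argument from A has zero B-component, and a multilinear f vanishes when an argument
  is zero. Hence inserting an A-valued cochain into an element of C(B, A) gives 0, which makes C(B,
  A) abelian.\<close>

lemma ext_zero_mem:
  assumes "f \<in> cochains sB sA n" "p \<in> set xs" "snd p = 0"
  shows "ext f T xs = 0"
proof -
  have "0 \<in> set (map snd xs)" using assms(2,3) by force
  then show ?thesis
    using cochains_zero_mem[OF assms(1) vsB vsA] by (simp add: ext_def zero_prod_def del: set_map)
qed

lemma circ_ext_eq_0:
  assumes "f \<in> cochains sB sA (Suc m)" "\<And>T xs. snd (g T xs) = 0"
  shows "circ (Suc m) (Suc n) i (ext f) g = 0"
proof (intro HOL.ext)
  fix T xs
  show "circ (Suc m) (Suc n) i (ext f) g T xs = 0 T xs"
    using assms(2) by (auto simp: circ_def intro!: ext_zero_mem[OF assms(1)])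
qed

lemma br_ext_ext:
  assumes "f \<in> cochains sB sA (Suc m)" "g \<in> cochains sB sA (Suc n)"
  shows "G.br m n (ext f) (ext g) = 0"
proof -
  have "snd (ext h T xs) = 0" for h :: "('b, 'a) cochain" and T and xs :: "('a \<times> 'b) list" by (simp add: ext_def)
  then show ?thesis
    using assms by (simp add: G.br_def pre_lie_def circ_ext_eq_0)
qed

section \<open>Closure of C(B, A) under the derived bracket\<close>

lemma snd_pi_cong:
  assumes "snd p = snd q" "snd p' = snd q'" "p = q \<and> snd p = 0 \<or> p' = q' \<and> snd p' = 0"
  shows "snd (\<pi> c T [p, p']) = snd (\<pi> c T [q, q'])"
  using assms by (cases p; cases q; cases p'; cases q') (auto simp: pi_cochain_def)

lemma snd_pi_eq_0:
  assumes "snd p = 0" "snd p' = 0"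
  shows "snd (\<pi> c T [p, p']) = 0"
  using assms by (cases p; cases p') (auto simp: pi_cochain_def)

lemma pi_zero: "\<pi> c T [0, p] = 0" "\<pi> c T [p, 0] = 0"
  by (cases p; simp add: pi_cochain_def zero_prod_def)+

lemma ext_cong: "map snd xs = map snd ys \<Longrightarrow> ext f T xs = ext f T ys"
  by (simp add: ext_def)

text \<open>Inserting an element of \<open>C(B, A)\<close> produces an argument in \<open>A\<close>. The predicate says what a
  cochain has to do with such an argument for the result to lie in \<open>C(B, A)\<close> again.\<close>

definition A_insertable :: "('a \<times> 'b, 'a \<times> 'b) cochain \<Rightarrow> bool" where
  "A_insertable F \<longleftrightarrow> (\<forall>T xs ys k. map snd xs = map snd ys \<longrightarrow> k < length xs \<longrightarrow> xs ! k = ys ! k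
    \<longrightarrow> snd (xs ! k) = 0 \<longrightarrow> snd (F T xs) = 0 \<and> F T xs = F T ys)"

text \<open>The argument from A either enters f, whose value is then 0, or is multiplied by the
  value of f; in that case both factors lie in A, so the product does too, and no other A-component
  is involved.\<close>

lemma A_insertable_circ_pi_left:
  assumes f: "f \<in> cochains sB sA (Suc m)" and i: "i \<le> Suc 0"
  shows "A_insertable (circ (Suc (Suc 0)) (Suc m) (Suc i) (\<pi> c) (ext f))"
  unfolding A_insertable_def
proof (intro allI impI)
  fix T k and xs ys :: "('a \<times> 'b) list"
  assume eq: "map snd xs = map snd ys" and k: "k < length xs" "xs ! k = ys ! k" "snd (xs ! k) = 0"
  let ?c = "circ (Suc (Suc 0)) (Suc m) (Suc i) (\<pi> c) (ext f)"
  have len: "length ys = length xs" using eq by (metis length_map)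
  show "snd (?c T xs) = 0 \<and> ?c T xs = ?c T ys"
  proof (cases "T \<in> trees (Suc (Suc 0 + m)) \<and> length xs = Suc (Suc 0 + m)")
    case True
    have z: "ext f R us = 0" if "xs ! k \<in> set us" for R us
      by (rule ext_zero_mem[OF f that k(3)])
    have s: "snd (ext f R us) = 0" for R us by (simp add: ext_def)
    show ?thesis
    proof (cases i)
      case 0
      define R where "R = R_inner (Suc (Suc 0)) (Suc 0) (Suc m) T"
      have e: "?c T zs = \<pi> c (R_outer (Suc (Suc 0)) (Suc 0) (Suc m) T) [ext f R (take (Suc m) zs), zs ! Suc m]"
        if "length zs = length xs" for zs
        using True that by (simp add: circ_def 0 R_def Cons_nth_drop_Suc[symmetric])
      have c: "ext f R (take (Suc m) xs) = ext f R (take (Suc m) ys)"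
        by (rule ext_cong) (simp add: take_map[symmetric] eq)
      show ?thesis
      \<comment> \<open>With f in the first slot of \<pi>, position \<open>Suc m\<close> is the only
        one that f does not consume.\<close>
      proof (cases "k = Suc m")
        case True
        then show ?thesis using e c len k s by (simp add: snd_pi_eq_0)
      next
        case False
        then have "xs ! k \<in> set (take (Suc m) xs)"
          using k \<open>T \<in> _ \<and> _\<close> by (auto simp: in_set_conv_nth intro!: exI[of _ k])
        then show ?thesis using e c len z by (simp add: pi_zero)
      qed
    next
      case (Suc i')
      then have 1: "i = Suc 0" using i by simp
      define R where "R = R_inner (Suc (Suc 0)) (Suc (Suc 0)) (Suc m) T"
      have e: "?c T zs = \<pi> c (R_outer (Suc (Suc 0)) (Suc (Suc 0)) (Suc m) T) [zs ! 0, ext f R (drop 1 zs)]"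
        if "length zs = length xs" for zs
        using True that by (cases zs) (simp_all add: circ_def 1 R_def)
      have c: "ext f R (drop 1 xs) = ext f R (drop 1 ys)"
        by (rule ext_cong) (simp add: drop_map[symmetric] eq)
      show ?thesis
      proof (cases "k = 0")
        case True
        then show ?thesis using e c len k s by (simp add: snd_pi_eq_0)
      next
        case False
        then have "xs ! k \<in> set (drop 1 xs)"
          using k by (auto simp: in_set_conv_nth intro!: exI[of _ "k - 1"])
        then show ?thesis using e c len z by (simp add: pi_zero)
      qed
    qed
  next
    case False
    then show ?thesis using len by (simp add: circ_outside)
  qed
qed

text \<open>If the argument from A enters \<pi>, the B-component of the product depends only on it
  and on the B-component of the other factor, and f reads nothing else. Otherwise f receives the
  argument itself and vanishes.\<close>

lemma A_insertable_circ_pi_right: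
  assumes f: "f \<in> cochains sB sA (Suc m)" and i: "i \<le> m"
  shows "A_insertable (circ (Suc m) (Suc (Suc 0)) (Suc i) (ext f) (\<pi> c))"
  unfolding A_insertable_def
proof (intro allI impI)
  fix T k and xs ys :: "('a \<times> 'b) list"
  assume eq: "map snd xs = map snd ys" and k: "k < length xs" "xs ! k = ys ! k" "snd (xs ! k) = 0"
  let ?c = "circ (Suc m) (Suc (Suc 0)) (Suc i) (ext f) (\<pi> c)"
  have len: "length ys = length xs" using eq by (metis length_map)
  show "snd (?c T xs) = 0 \<and> ?c T xs = ?c T ys"
  proof (cases "T \<in> trees (Suc (m + Suc 0)) \<and> length xs = Suc (m + Suc 0)")
    case True
    define R R' where "R = R_outer (Suc m) (Suc i) (Suc (Suc 0)) T"
      and "R' = R_inner (Suc m) (Suc i) (Suc (Suc 0)) T"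
    have e: "?c T zs = ext f R (take i zs @ \<pi> c R' [zs ! i, zs ! Suc i] # drop (Suc (Suc i)) zs)"
      if "length zs = length xs" for zs
      using True that i by (simp add: circ_def R_def R'_def take_Suc_conv_app_nth Cons_nth_drop_Suc[symmetric])
    have nth: "snd (xs ! j) = snd (ys ! j)" if "j < length xs" for j
      using eq that len by (metis nth_map)
    have "?c T xs = ?c T ys"
    proof (cases "k = i \<or> k = Suc i")
      case k': True
      have "snd (\<pi> c R' [xs ! i, xs ! Suc i]) = snd (\<pi> c R' [ys ! i, ys ! Suc i])"
        using k k' nth True i by (intro snd_pi_cong) auto
      then show ?thesis
        using len eq by (auto simp: e take_map[symmetric] drop_map[symmetric] intro!: ext_cong)
    next
      case k': False
      have "zs ! k \<in> set (take i zs) \<union> set (drop (Suc (Suc i)) zs)" if "k < length zs" for zs :: "('a \<times> 'b) list"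
      proof (cases "k < i")
        case True
        then show ?thesis using that by (auto simp: in_set_conv_nth intro!: exI[of _ k])
      next
        case False
        then have "Suc (Suc i) \<le> k" using k' by linarith
        then have "drop (Suc (Suc i)) zs ! (k - Suc (Suc i)) = zs ! k"
          "k - Suc (Suc i) < length (drop (Suc (Suc i)) zs)"
          using that by (simp_all only: nth_drop le_add_diff_inverse length_drop diff_less_mono)
        then show ?thesis by (metis UnI2 nth_mem)
      qed
      then have "?c T zs = 0" if "length zs = length xs" "snd (zs ! k) = 0" for zs
        using that k(1) unfolding e[OF that(1)] by (intro ext_zero_mem[OF f, of "zs ! k"]) auto
      then show ?thesis using k len by simp
    qed
    moreover have "snd (?c T xs) = 0" unfolding e[OF refl] by (simp add: ext_def)
    ultimately show ?thesis by simp
  next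
    case False
    then show ?thesis using len by (simp add: circ_outside)
  qed
qed

text \<open>The value of \<open>ext g\<close> lies in A and depends on B-components alone, so it can
  serve as the distinguished argument of F, at position i.\<close>

lemma circ_range_ext_of_A_insertable:
  assumes F: "A_insertable F" and i: "i \<le> m"
  shows "circ (Suc m) (Suc n) (Suc i) F (ext g) \<in> range ext"
proof -
  have "snd (circ (Suc m) (Suc n) (Suc i) F (ext g) T xs) = 0 \<and>
      circ (Suc m) (Suc n) (Suc i) F (ext g) T xs = circ (Suc m) (Suc n) (Suc i) F (ext g) T ys"
    if eq: "map snd xs = map snd ys" for T and xs ys :: "('a \<times> 'b) list"
  proof (cases "T \<in> trees (Suc (m + n)) \<and> length xs = Suc (m + n)")
    case True
    have len: "length ys = length xs" using eq by (metis length_map)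
    define R R' where "R = R_outer (Suc m) (Suc i) (Suc n) T" and "R' = R_inner (Suc m) (Suc i) (Suc n) T"
    define u where "u zs = take i zs @ ext g R' (take (Suc n) (drop i zs)) # drop (Suc (i + n)) zs"
      for zs :: "('a \<times> 'b) list"
    have e: "circ (Suc m) (Suc n) (Suc i) F (ext g) T zs = F R (u zs)" if "length zs = length xs" for zs
      using True that by (simp add: circ_def R_def R'_def u_def)
    have x: "ext g R' (take (Suc n) (drop i xs)) = ext g R' (take (Suc n) (drop i ys))"
      by (rule ext_cong) (simp add: take_map[symmetric] drop_map[symmetric] eq)
    have "snd (F R (u xs)) = 0 \<and> F R (u xs) = F R (u ys)"
    proof (rule F[unfolded A_insertable_def, rule_format])
      show "map snd (u xs) = map snd (u ys)"
        using eq x by (simp add: u_def take_map[symmetric] drop_map[symmetric])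
      have l: "length (take i xs) = i" "length (take i ys) = i" using True len i by auto
      show "i < length (u xs)" using l by (simp add: u_def)
      show "u xs ! i = u ys ! i" using l x by (simp add: u_def nth_append)
      show "snd (u xs ! i) = 0" using l by (simp add: u_def nth_append ext_def)
    qed
    then show ?thesis using e[of xs] e[of ys] len by metis
  next
    case False
    moreover have "length ys = length xs" using eq by (metis length_map)
    ultimately show ?thesis by (simp add: circ_outside)
  qed
  then show ?thesis unfolding range_ext_iff by blast
qed

text \<open>\<open>ext g\<close> reads only the B-component of the value of F, so the A-component of
  that value is unrestricted.\<close>

lemma circ_ext_range_ext:
  fixes F :: "('a \<times> 'b, 'a \<times> 'b) cochain"
  assumes "\<And>T xs ys. map snd xs = map snd ys \<Longrightarrow> snd (F T xs) = snd (F T ys)"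
  shows "circ m n i (ext g) F \<in> range ext"
  unfolding range_ext_iff
proof (intro conjI allI impI)
  show "snd (circ m n i (ext g) F T xs) = 0" for T xs by (simp add: circ_def ext_def)
  fix T and xs ys :: "('a \<times> 'b) list"
  assume eq: "map snd xs = map snd ys"
  have "length ys = length xs" using eq by (metis length_map)
  moreover have "snd (F R (take n (drop (i - 1) xs))) = snd (F R (take n (drop (i - 1) ys)))" for R
    by (rule assms) (simp add: take_map[symmetric] drop_map[symmetric] eq)
  ultimately show "circ m n i (ext g) F T xs = circ m n i (ext g) F T ys"
    using eq by (simp add: circ_def ext_def take_map[symmetric] drop_map[symmetric])
qed

lemma snd_circ_pi_ext:
  assumes eq: "map snd xs = map snd ys" and i: "i \<le> Suc 0"
  shows "snd (circ (Suc (Suc 0)) (Suc m) (Suc i) (\<pi> c) (ext f) T xs)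
    = snd (circ (Suc (Suc 0)) (Suc m) (Suc i) (\<pi> c) (ext f) T ys)"
proof (cases "T \<in> trees (Suc (Suc 0 + m)) \<and> length xs = Suc (Suc 0 + m)")
  case True
  have len: "length ys = length xs" using eq by (metis length_map)
  have nth: "snd (xs ! j) = snd (ys ! j)" if "j < length xs" for j
    using eq that len by (metis nth_map)
  have s: "snd (ext f R us) = 0" for R us by (simp add: ext_def)
  show ?thesis
  proof (cases i)
    case 0
    define R where "R = R_inner (Suc (Suc 0)) (Suc 0) (Suc m) T"
    have e: "circ (Suc (Suc 0)) (Suc m) (Suc i) (\<pi> c) (ext f) T zs
        = \<pi> c (R_outer (Suc (Suc 0)) (Suc 0) (Suc m) T) [ext f R (take (Suc m) zs), zs ! Suc m]"
      if "length zs = length xs" for zs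
      using True that by (simp add: circ_def 0 R_def Cons_nth_drop_Suc[symmetric])
    have "ext f R (take (Suc m) xs) = ext f R (take (Suc m) ys)"
      by (rule ext_cong) (simp add: take_map[symmetric] eq)
    then show ?thesis using nth[of "Suc m"] True s len by (auto simp: e intro!: snd_pi_cong)
  next
    case (Suc i')
    then have 1: "i = Suc 0" using i by simp
    define R where "R = R_inner (Suc (Suc 0)) (Suc (Suc 0)) (Suc m) T"
    have e: "circ (Suc (Suc 0)) (Suc m) (Suc i) (\<pi> c) (ext f) T zs
        = \<pi> c (R_outer (Suc (Suc 0)) (Suc (Suc 0)) (Suc m) T) [zs ! 0, ext f R (drop 1 zs)]"
      if "length zs = length xs" for zs
      using True that by (cases zs) (simp_all add: circ_def 1 R_def)
    have "ext f R (drop 1 xs) = ext f R (drop 1 ys)"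
      by (rule ext_cong) (simp add: drop_map[symmetric] eq)
    then show ?thesis using nth[of 0] True s len by (auto simp: e intro!: snd_pi_cong)
  qed
next
  case False
  moreover have "length ys = length xs" using eq by (metis length_map)
  ultimately show ?thesis by (simp add: circ_outside)
qed

text \<open>The two halves of the bracket of [\<pi>, f] with g need different reasons. Inserting g
  uses \<open>A_insertable\<close>; inserting [\<pi>, f] into g uses that the B-component of
  [\<pi>, f] ignores the A-components of the arguments.\<close>

lemma derived_range_ext:
  assumes f: "f \<in> cochains sB sA (Suc m)"
  shows "G.derived (\<pi> c) m n (ext f) (ext g) \<in> range ext"
proof -
  have snd_ext: "snd (circ k l i (ext h) F T xs) = 0" for k l i and h :: "('b, 'a) cochain" and F T xs
    by (simp add: circ_def ext_def)
  have ins: "A_insertable (sgn_pow l F)" "A_insertable (F + F')" "A_insertable (F - F')"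
    if F: "A_insertable F" "A_insertable F'" for F F' l
  proof -
    have *: "snd (sgn_pow l F T xs) = 0 \<and> sgn_pow l F T xs = sgn_pow l F T ys"
      "snd ((F + F') T xs) = 0 \<and> (F + F') T xs = (F + F') T ys"
      "snd ((F - F') T xs) = 0 \<and> (F - F') T xs = (F - F') T ys"
      if "map snd xs = map snd ys" "k < length xs" "xs ! k = ys ! k" "snd (xs ! k) = 0" for T xs ys k
    proof -
      have "snd (F T xs) = 0 \<and> F T xs = F T ys" "snd (F' T xs) = 0 \<and> F' T xs = F' T ys"
        using F that unfolding A_insertable_def by blast+
      then show "snd (sgn_pow l F T xs) = 0 \<and> sgn_pow l F T xs = sgn_pow l F T ys"
        "snd ((F + F') T xs) = 0 \<and> (F + F') T xs = (F + F') T ys"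
        "snd ((F - F') T xs) = 0 \<and> (F - F') T xs = (F - F') T ys"
        by (auto simp: sgn_pow_def)
    qed
    show "A_insertable (sgn_pow l F)"
      unfolding A_insertable_def by (intro allI impI, rule *(1); assumption)
    show "A_insertable (F + F')"
      unfolding A_insertable_def by (intro allI impI, rule *(2); assumption)
    show "A_insertable (F - F')"
      unfolding A_insertable_def by (intro allI impI, rule *(3); assumption)
  qed
  have ins_sgn: "A_insertable F \<Longrightarrow> A_insertable (sgn_pow l F)" for F l by (rule ins(1))
  have ins_zero: "A_insertable 0" by (simp add: A_insertable_def)
  have ins_sum: "(\<And>i. i \<in> I \<Longrightarrow> A_insertable (F i)) \<Longrightarrow> A_insertable (sum F I)" for F and I :: "nat set"
    by (induction I rule: infinite_finite_induct) (auto intro: ins ins_zero)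
  define \<Phi> where "\<Phi> = G.br (Suc 0) m (\<pi> c) (ext f)"
  have "A_insertable \<Phi>"
    unfolding \<Phi>_def G.br_def pre_lie_def
    by (intro ins(3) ins_sgn ins_sum A_insertable_circ_pi_left[OF f] A_insertable_circ_pi_right[OF f]) auto
  then have "pre_lie (Suc m) n \<Phi> (ext g) \<in> range ext"
    by (intro pre_lie_range_ext circ_range_ext_of_A_insertable)
  moreover have "snd (\<Phi> T xs) = snd (\<Phi> T ys)" if "map snd xs = map snd ys" for T xs ys
  proof -
    have "snd (sgn_pow k p) = sgn_pow k (snd p)" for k and p :: "'a \<times> 'b"
      by (simp add: sgn_pow_def)
    moreover have "(sgn_pow k F) T xs = sgn_pow k (F T xs)" for k and F :: "('a \<times> 'b, 'a \<times> 'b) cochain" and T xs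
      by (simp add: sgn_pow_def)
    \<comment> \<open>\<open>ext f\<close> takes values in A, so the half with \<pi> inserted into f
      contributes nothing to the B-component.\<close>
    ultimately have "snd (\<Phi> T zs) = (\<Sum>i\<le>Suc 0. sgn_pow (i * m)
        (snd (circ (Suc (Suc 0)) (Suc m) (Suc i) (\<pi> c) (ext f) T zs)))" for zs
      unfolding \<Phi>_def G.br_def by (simp add: pre_lie_apply snd_sum snd_ext)
    then show ?thesis using snd_circ_pi_ext[OF that] by simp
  qed
  then have "pre_lie n (Suc m) (ext g) \<Phi> \<in> range ext"
    by (intro pre_lie_range_ext circ_ext_range_ext)
  ultimately have "G.br (Suc m) n \<Phi> (ext g) \<in> range ext"
    unfolding G.br_def diff_conv_add_uminus
    by (intro range_ext_add range_ext_minus range_ext_sgn_pow)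
  then show ?thesis
    unfolding G.derived_def \<Phi>_def by (rule range_ext_sgn_pow)
qed

lemma derived_bracket_eq:
  "derived_bracket sB lact ract c (Suc m) (Suc n) f g = G.derived (\<pi> c) m n (ext f) (ext g)"
proof -
  have "derived_bracket sB lact ract c (Suc m) (Suc n) f g = sgn_pow (Suc m)
      (gbracket (Suc (Suc m)) (Suc n) (gbracket (Suc (Suc 0)) (Suc m) (\<pi> c) (ext f)) (ext g))"
    by (simp add: derived_bracket_def numeral_2_eq_2)
  then show ?thesis
    by (simp only: gbracket_pre_lie G.derived_def G.br_def)
qed

text \<open>Membership in \<open>range ext\<close> and multilinearity have independent sources, and
  \<open>ext_closed_iff\<close> joins them. This is what makes \<open>the_inv_into\<close> in
  \<open>dbracket\<close> return a genuine preimage.\<close>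

lemma derived_bracket_closed:
  assumes f: "f \<in> cochains sB sA (Suc m)" and g: "g \<in> cochains sB sA (Suc n)"
  shows "derived_bracket sB lact ract c (Suc m) (Suc n) f g \<in> ext ` cochains sB sA (Suc m + Suc n)"
proof -
  obtain h where h: "derived_bracket sB lact ract c (Suc m) (Suc n) f g = ext h"
    using derived_range_ext[OF f] unfolding derived_bracket_eq by blast
  have "ext h \<in> cochains sD sD (Suc (Suc (m + n)))"
    using f g unfolding h[symmetric] derived_bracket_eq
    by (intro G.derived_closed pi_closed) (simp_all add: ext_closed_iff)
  then show ?thesis using h by (simp add: ext_closed_iff)
qed

lemma ext_dbracket:
  assumes "f \<in> cochains sB sA (Suc m)" "g \<in> cochains sB sA (Suc n)"
  shows "ext (dbracket sA sB lact ract c (Suc m) (Suc n) f g) = G.derived (\<pi> c) m n (ext f) (ext g)"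
  using f_the_inv_into_f[OF inj_on_subset[OF inj_ext subset_UNIV] derived_bracket_closed[OF assms]]
  unfolding dbracket_def derived_bracket_eq .

lemma dbracket_closed:
  assumes "f \<in> cochains sB sA (Suc m)" "g \<in> cochains sB sA (Suc n)"
  shows "dbracket sA sB lact ract c (Suc m) (Suc n) f g \<in> cochains sB sA (Suc (Suc (m + n)))"
  using assms G.derived_closed[OF pi_closed, of "ext f" m "ext g" n c]
  by (simp flip: ext_closed_iff add: ext_dbracket)

section \<open>The differential as a bracket\<close>

definition \<rho> :: "'k \<Rightarrow> ('a \<times> 'b, 'a \<times> 'b) cochain" where
  "\<rho> c = \<pi> c - \<pi> 0"

lemma rho_closed: "\<rho> c \<in> cochains sD sD (Suc (Suc 0))"
  unfolding \<rho>_def by (intro G.C_diff pi_closed)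

text \<open>By bilinearity this is the difference of two instances of \<open>pi_pi\<close>, with
  scalars c, d and 0, d; hence the need for two independent scalars there.\<close>

lemma br_rho_pi: "G.br (Suc 0) (Suc 0) (\<rho> c) (\<pi> d) = 0"
  using G.br_add_left[OF rho_closed pi_closed pi_closed, of c 0 d] by (simp add: \<rho>_def pi_pi)

lemma br_rho_rho: "G.br (Suc 0) (Suc 0) (\<rho> c) (\<rho> d) = 0"
  using G.br_add_right[OF rho_closed rho_closed pi_closed, of c d 0] br_rho_pi[of c d] br_rho_pi[of c 0]
  by (simp add: \<rho>_def)

lemma rho_apply: "\<rho> c T [p, q] = (0, pi_B sB c T (snd p) (snd q))"
  by (cases p; cases q) (simp add: \<rho>_def pi_cochain_def pi_B_def zero_prod_def T_left_def T_right_def T_perp_def)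

lemma sgn_pow_Pair_zero: "sgn_pow k (u, 0) = (sgn_pow k u, 0)"
  by (simp add: sgn_pow_def)

lemma sum_Pair_zero: "(\<Sum>i\<in>I. (g i, 0)) = (\<Sum>i\<in>I. g i, 0)"
  by (simp add: prod_eq_iff fst_sum snd_sum)

text \<open>The face deleting leaf i is the outer tree for an inner cochain of arity 2, and
  inserting \<rho>, of degree one, in slot i counted from 0 carries the sign (-1)^i.\<close>

lemma differential_apply:
  assumes "T \<in> trees (Suc (n + Suc 0))" "length xs = Suc (n + Suc 0)"
  shows "ext (differential sB c (Suc n) f) T xs = sgn_pow n (pre_lie n (Suc 0) (ext f) (\<rho> c) T xs)"
proof -
  have "ext (differential sB c (Suc n) f) T xs = (sgn_pow n (\<Sum>i\<le>n. sgn_pow i (f (face (Suc i) T)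
      (take i (map snd xs) @ [pi_B sB c (R_inner (Suc n) (Suc i) 2 T) (map snd xs ! i) (map snd xs ! Suc i)]
        @ drop (Suc (Suc i)) (map snd xs)))), 0)"
    using assms by (simp add: ext_def differential_def sum.atLeast1_atMost_eq lessThan_Suc_atMost
        del: sum.lessThan_Suc sum.atMost_Suc sum.cl_ivl_Suc)
  also have "\<dots> = sgn_pow n (\<Sum>i\<le>n. sgn_pow i (f (face (Suc i) T)
      (take i (map snd xs) @ [pi_B sB c (R_inner (Suc n) (Suc i) 2 T) (map snd xs ! i) (map snd xs ! Suc i)]
        @ drop (Suc (Suc i)) (map snd xs)), 0))"
    by (simp add: sgn_pow_Pair_zero sum_Pair_zero)
  also have "\<dots> = sgn_pow n (pre_lie n (Suc 0) (ext f) (\<rho> c) T xs)"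
    unfolding pre_lie_apply
  proof (intro arg_cong[of _ _ "sgn_pow n"] sum.cong refl)
    fix i assume "i \<in> {..n}"
    then have "circ (Suc n) (Suc (Suc 0)) (Suc i) (ext f) (\<rho> c) T xs = (f (face (Suc i) T)
      (take i (map snd xs) @ [pi_B sB c (R_inner (Suc n) (Suc i) 2 T) (map snd xs ! i) (map snd xs ! Suc i)]
        @ drop (Suc (Suc i)) (map snd xs)), 0)"
      using assms by (simp add: circ_def take_Suc_conv_app_nth Cons_nth_drop_Suc[symmetric] rho_apply
          ext_def take_map drop_map R_outer_def face_def numeral_2_eq_2)
    then show "sgn_pow i (f (face (Suc i) T)
      (take i (map snd xs) @ [pi_B sB c (R_inner (Suc n) (Suc i) 2 T) (map snd xs ! i) (map snd xs ! Suc i)]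
        @ drop (Suc (Suc i)) (map snd xs)), 0)
      = sgn_pow (i * Suc 0) (circ (Suc n) (Suc (Suc 0)) (Suc i) (ext f) (\<rho> c) T xs)"
      by simp
  qed
  finally show ?thesis .
qed

text \<open>\<rho> vanishes as soon as one factor lies in A, so f inserted in \<rho> contributes
  nothing. The other half of the bracket carries -(-1)^n, and the outer minus leaves the (-1)^n of
  the differential in arity \<open>Suc n\<close>.\<close>

lemma ext_differential:
  "ext (differential sB c (Suc n) f) = - G.br (Suc 0) n (\<rho> c) (ext f)"
proof -
  have rho_zero: "\<rho> c R [p, q] = 0" if "snd p = 0 \<or> snd q = 0" for R p q
    using that by (auto simp: rho_apply pi_B_def zero_prod_def)
  have "circ (Suc (Suc 0)) (Suc n) (Suc i) (\<rho> c) (ext f) = 0" if "i \<le> Suc 0" for i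
  proof (intro HOL.ext)
    fix T and xs :: "('a \<times> 'b) list"
    show "circ (Suc (Suc 0)) (Suc n) (Suc i) (\<rho> c) (ext f) T xs = 0 T xs"
    proof (cases "length xs = Suc (Suc 0 + n)")
      case True
      then obtain p ps where "xs = p # ps" by (cases xs) auto
      then show ?thesis
        using that True by (cases i) (auto simp: circ_def rho_zero ext_def Cons_nth_drop_Suc[symmetric])
    qed (simp add: circ_outside)
  qed
  then have "pre_lie (Suc 0) n (\<rho> c) (ext f) = 0" by (simp add: pre_lie_def)
  then have br: "- G.br (Suc 0) n (\<rho> c) (ext f) = sgn_pow n (pre_lie n (Suc 0) (ext f) (\<rho> c))"
    by (simp add: G.br_def)
  show ?thesis unfolding br
  proof (intro HOL.ext)
    fix T and xs :: "('a \<times> 'b) list"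
    show "ext (differential sB c (Suc n) f) T xs = sgn_pow n (pre_lie n (Suc 0) (ext f) (\<rho> c)) T xs"
    proof (cases "T \<in> trees (Suc (n + Suc 0)) \<and> length xs = Suc (n + Suc 0)")
      case True
      then have "ext (differential sB c (Suc n) f) T xs = sgn_pow n (pre_lie n (Suc 0) (ext f) (\<rho> c) T xs)"
        by (intro differential_apply) auto
      then show ?thesis by (simp add: sgn_pow_def)
    next
      case False
      then have "pre_lie n (Suc 0) (ext f) (\<rho> c) T xs = 0" by (rule pre_lie_outside)
      moreover have "differential sB c (Suc n) f T (map snd xs) = 0"
        using False by (auto simp: differential_def)
      ultimately show ?thesis by (simp add: sgn_pow_def ext_def zero_prod_def)
    qed
  qed
qed

lemma differential_closed:
  assumes "f \<in> cochains sB sA (Suc n)"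
  shows "differential sB c (Suc n) f \<in> cochains sB sA (Suc (Suc n))"
  using assms by (simp flip: ext_closed_iff add: ext_differential G.C_minus G.br_1_closed rho_closed)

text \<open>Each equational axiom may be checked after the injective map \<open>ext\<close>, where
  it concerns \<open>G.derived\<close> and brackets with \<rho>. Degree n there is arity
  \<open>Suc n\<close>, so the exponent \<open>Suc m * Suc n\<close> in the derived skew symmetry
  and Jacobi identities is the product of the degrees in the grading by arity.\<close>

lemma dgla: "positively_graded_dgla (scale_cochain sA) (cochains sB sA)
    (dbracket sA sB lact ract c) (differential sB c)"
proof -
  interpret V: vector_space "scale_cochain sA" by (rule vector_space_scale_cochain[OF vsA])
  let ?L = "cochains sB sA" and ?b = "dbracket sA sB lact ract c" and ?d = "differential sB c"
  note eqI = injD[OF inj_ext]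
  have add: "f + g \<in> ?L n" and scale: "scale_cochain sA k f \<in> ?L n" if "f \<in> ?L n" "g \<in> ?L n" for f g n k
    using subspace_cochains[OF vsB vsA, of n] that
    by (auto intro: V.subspace_add V.subspace_scale)
  have e: "ext f \<in> cochains sD sD n" if "f \<in> ?L n" for f n
    using that by (simp add: ext_closed_iff)
  note br = ext_dbracket e
  show ?thesis
  proof
    show "V.subspace (?L n)" for n by (rule subspace_cochains[OF vsB vsA])
  next
    fix m n :: nat and f g assume "1 \<le> m" "1 \<le> n" and fg: "f \<in> ?L m" "g \<in> ?L n"
    then obtain m' n' where mn: "m = Suc m'" "n = Suc n'" by (metis Suc_le_D One_nat_def)
    note fg = fg[unfolded mn]
    show "?b m n f g \<in> ?L (m + n)"
      using dbracket_closed[OF fg] by (simp add: mn)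
    show "?b m n (scale_cochain sA k f) g = scale_cochain sA k (?b m n f g)" for k
      unfolding mn by (rule eqI)
        (simp add: br fg scale[OF fg(1) fg(1)] ext_scale G.derived_def G.br_scale_left G.br_scale_right
          pi_closed G.br_1_closed G.scale_sgn_pow)
    show "?b m n f (scale_cochain sA k g) = scale_cochain sA k (?b m n f g)" for k
      unfolding mn by (rule eqI)
        (simp add: br fg scale[OF fg(2) fg(2)] ext_scale G.derived_def G.br_scale_left G.br_scale_right
          pi_closed G.br_1_closed G.scale_sgn_pow)
    show "?b m n f g = - sgn_pow (m * n) (?b n m g f)"
      unfolding mn using G.derived_skew[OF pi_closed e[OF fg(1)] e[OF fg(2)] br_ext_ext[OF fg]]
      by - (rule eqI, simp only: br fg ext_minus ext_sgn_pow)
    show "?d (m + n) (?b m n f g) = ?b (m + 1) n (?d m f) g + sgn_pow m (?b m (n + 1) f (?d n g))"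
      using G.derived_leibniz[OF rho_closed pi_closed br_rho_pi e[OF fg(1)] e[OF fg(2)], of c c]
      by - (rule eqI, simp add: mn ext_add ext_sgn_pow ext_dbracket ext_differential differential_closed fg)
    show "?b m n (f + f') g = ?b m n f g + ?b m n f' g" if "f' \<in> ?L m" for f'
      using that fg unfolding mn
      by - (rule eqI, simp add: br add ext_add G.derived_def G.br_add_left G.br_add_right pi_closed
          G.br_1_closed sgn_pow_add)
    show "?b m n f (g + g') = ?b m n f g + ?b m n f g'" if "g' \<in> ?L n" for g'
      using that fg unfolding mn
      by - (rule eqI, simp add: br add ext_add G.derived_def G.br_add_left G.br_add_right pi_closed
          G.br_1_closed sgn_pow_add)
    show "?b m (n + p) f (?b n p g h) =
        ?b (m + n) p (?b m n f g) h + sgn_pow (m * n) (?b n (m + p) g (?b m p f h))"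
      if "1 \<le> p" "h \<in> ?L p" for p h
    proof -
      obtain p' where p: "p = Suc p'" using \<open>1 \<le> p\<close> by (metis Suc_le_D One_nat_def)
      note h = \<open>h \<in> ?L p\<close>[unfolded p]
      show ?thesis
        using G.derived_jacobi[OF pi_closed pi_pi e[OF fg(1)] e[OF fg(2)] e[OF h]]
        by - (rule eqI, simp add: mn p ext_add ext_sgn_pow ext_dbracket dbracket_closed fg h)
    qed
  next
    fix n :: nat and f assume "1 \<le> n" and f: "f \<in> ?L n"
    then obtain n' where n: "n = Suc n'" by (metis Suc_le_D One_nat_def)
    note f = f[unfolded n]
    show "?d n f \<in> ?L (n + 1)" using differential_closed[OF f] by (simp add: n)
    show "?d n (scale_cochain sA k f) = scale_cochain sA k (?d n f)" for k
      unfolding n by (rule eqI)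
        (simp add: ext_differential ext_scale G.br_scale_right[OF rho_closed e[OF f]])
    show "?d (n + 1) (?d n f) = 0"
      by (rule eqI) (simp add: n ext_differential ext_zero G.br_minus_right[OF rho_closed]
          G.br_1_closed rho_closed e[OF f] G.br_1_square br_rho_rho)
    show "?d n (f + f') = ?d n f + ?d n f'" if "f' \<in> ?L n" for f'
      using that f unfolding n
      by - (rule eqI, simp add: ext_differential ext_add G.br_add_right rho_closed e)
  qed
qed

end

theorem proposition4p12:
  fixes sA :: "'k::field_char_0 \<Rightarrow> 'a::ring \<Rightarrow> 'a"
    and sB :: "'k \<Rightarrow> 'b::ring \<Rightarrow> 'b"
    and lact :: "'a \<Rightarrow> 'b \<Rightarrow> 'b" and ract :: "'b \<Rightarrow> 'a \<Rightarrow> 'b"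
    and lam :: 'k
  assumes "assoc_bimodule sA sB lact ract"
    and "lam \<noteq> 0"
  shows "(\<forall>m\<ge>1. \<forall>n\<ge>1. \<forall>f\<in>cochains sB sA m. \<forall>g\<in>cochains sB sA n.
            derived_bracket sB lact ract lam m n f g \<in> ext ` cochains sB sA (m + n))
    \<and> positively_graded_dgla (scale_cochain sA) (cochains sB sA)
          (dbracket sA sB lact ract lam) (differential sB lam)"
proof -
  interpret bimodule_char_0 sA sB lact ract
    using assms(1) by (simp add: bimodule_char_0_def)
  have "derived_bracket sB lact ract lam m n f g \<in> ext ` cochains sB sA (m + n)"
    if "1 \<le> m" "1 \<le> n" "f \<in> cochains sB sA m" "g \<in> cochains sB sA n" for m n f g
    using that derived_bracket_closed[of f "m - 1" g "n - 1"] by simp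
  then show ?thesis using dgla by blast
qed

end
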